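(* Let $d\ge 2$ and let $K\subset\mathbb{R}^d$ be a convex body with center of gravity $\mathbf{cg}(K)$. Let $v\in\mathbb{R}^d$ with $\|v\|=1$, let $W=\{w:\langle v,w\rangle=0\}$, and define $K^+=K\cap\{w:\langle v,w\rangle\ge 0\}$ and $K^-=K\cap\{w:\langle v,w\rangle<0\}$, both assumed nonempty with $K\cap W$ of positive $(d-1)$-dimensional volume. Let $H_{K^+}=\max_{a\in K^+}\langle a,v\rangle$ and $H_{K^-}=\sup_{a\in K^-}\bigl(-\langle a,v\rangle\bigr)$ (the largest distance along $v$ from $W$ to a point of $K^-$). Let $R$ be the radius of the $(d-1)$-dimensional ball whose $(d-1)$-volume equals that of $K\cap W$, and let $\omega_{d-1}$ be the volume of the unit ball of $\mathbb{R}^{d-1}$. For $\lambda\in[0,1]$ set $$\Lambda=\lambda\,\frac{d\,\mathrm{V}(K)}{\omega_{d-1}R^{d-1}}\left[\frac{H_{K^+}}{(d+1)H_{K^-}}\right]^{d-1}\left(1-\frac{1}{d+1}\right).$$ If $\mathbf{cg}(K)+\Lambda v\in K^+$, then $$\frac{\mathrm{V}(K^+)}{\mathrm{V}(K)}\ \ge\ e^{-1}(1-\lambda)^{d}.$$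
   Context: $\mathrm{V}(\cdot)$ denotes $d$-dimensional Lebesgue volume. The center of gravity of a convex body $K$ is $\mathbf{cg}(K)=\int_K z\,dz\big/\int_K dz$. A convex body is a compact convex set with nonempty interior. *)

theory Defs
  imports "HOL-Analysis.Analysis"
begin

definition convex_body :: "'a::euclidean_space set \<Rightarrow> bool" where
  "convex_body K \<longleftrightarrow> compact K \<and> convex K \<and> interior K \<noteq> {}"

definition cg :: "'a::euclidean_space set \<Rightarrow> 'a" where
  "cg K = (1 / measure lebesgue K) *\<^sub>R integral K (\<lambda>z. z)"

text \<open>(d-1)-dimensional volume of a set S contained in the hyperplane orthogonal
  to the unit vector v: the d-volume of the right cylinder of height 1 over S.\<close>
definition hyp_vol :: "'a::euclidean_space \<Rightarrow> 'a set \<Rightarrow> real" where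
  "hyp_vol v S = measure lebesgue {w + t *\<^sub>R v | w t. w \<in> S \<and> t \<in> {0..1}}"

end

theory Submission
  imports Defs
begin

text \<open>
  Write \<open>P\<close>, \<open>M\<close> for the extents of \<open>K\<close> above and below \<open>W\<close>, \<open>h\<close> for the volume of the slices of \<open>K\<close>
  orthogonal to \<open>v\<close>, and \<open>x = (V(K\<^sup>+) / V(K)) ^ (1/d)\<close>. A homothety with ratio \<open>P / (P + M)\<close> centred
  at a highest point of \<open>K\<close> maps \<open>K\<close> into \<open>K\<^sup>+\<close>, so \<open>x \<ge> P / (P + M)\<close>; this settles the case
  \<open>P \<ge> d M\<close>. In general, by Brunn's theorem the \<open>(d-1)\<close>-st root of \<open>h\<close> is concave, and as in
  Gruenbaum's inequality the centre of gravity is at most as high as that of the cone with apex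
  \<open>\<tau> = d V(K\<^sup>+) / h(0)\<close> and height \<open>\<tau> / x\<close>. Hence \<open>-\<Lambda> \<le> \<tau> - (\<tau> / x) d / (d + 1)\<close>, and when
  \<open>P < d M\<close> the bound on \<open>x\<close> gives \<open>\<Lambda> \<le> \<lambda> (\<tau> / x) d / (d + 1)\<close>, so \<open>x \<ge> (1 - \<lambda>) d / (d + 1)\<close>.
\<close>

section \<open>The Brunn--Minkowski inequality for convex sets\<close>

lemma open_set_plus:
  fixes A B :: "'a::real_normed_vector set"
  assumes "open A"
  shows "open (A + B)"
proof -
  have "A + B = (\<Union>x\<in>A. \<Union>y\<in>B. {x + y})"
    by (auto simp: set_plus_def)
  then show ?thesis
    using open_sums assms by metis
qed

lemma bounded_set_plus:
  fixes A B :: "'a::real_normed_vector set"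
  assumes "bounded A" "bounded B"
  shows "bounded (A + B)"
proof -
  have "A + B = (\<Union>x\<in>A. \<Union>y\<in>B. {x + y})"
    by (auto simp: set_plus_def)
  then show ?thesis
    using bounded_sums assms by metis
qed

lemma compact_set_plus:
  fixes A B :: "'a::real_normed_vector set"
  assumes "compact A" "compact B"
  shows "compact (A + B)"
proof -
  have "A + B = (\<Union>x\<in>A. \<Union>y\<in>B. {x + y})"
    by (auto simp: set_plus_def)
  then show ?thesis
    using compact_sums' assms by metis
qed

section \<open>The inequality for two boxes\<close>

lemma measure_box:
  fixes a b :: "'a::euclidean_space"
  assumes "\<And>i. i \<in> Basis \<Longrightarrow> a \<bullet> i < b \<bullet> i"
  shows "measure lebesgue (box a b) = (\<Prod>i\<in>Basis. b \<bullet> i - a \<bullet> i)"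
  using assms by (auto simp: measure_lborel_box_eq inner_diff_left dest: less_imp_le)

text \<open>The ratios \<open>u i / (u i + w i)\<close> and \<open>w i / (u i + w i)\<close> add up
  to 1 for each index. The arithmetic-geometric mean inequality for both families therefore bounds
  the sum of their geometric means by 1. The common factor \<open>s\<close> is the one carried
  through the later induction.\<close>

lemma prod_add_ge:
  fixes u w :: "'i \<Rightarrow> real"
  assumes I: "finite I" "I \<noteq> {}"
    and pos: "\<And>i. i \<in> I \<Longrightarrow> u i > 0" "\<And>i. i \<in> I \<Longrightarrow> w i > 0"
    and "\<alpha> > 0" "\<beta> > 0" "s > 0"
    and u: "(\<Prod>i\<in>I. u i) = \<alpha> ^ card I * s" and w: "(\<Prod>i\<in>I. w i) = \<beta> ^ card I * s"
  shows "(\<alpha> + \<beta>) ^ card I * s \<le> (\<Prod>i\<in>I. u i + w i)"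
proof -
  define n where "n = card I"
  have n: "n > 0"
    using I by (simp add: n_def card_gt_0_iff)
  define S where "S = (\<Prod>i\<in>I. u i + w i)"
  have S: "S > 0"
    unfolding S_def by (intro prod_pos) (use pos in \<open>force intro: add_pos_pos\<close>)
  \<comment> \<open>With this \<open>q\<close>, the two geometric means are
    \<open>\<alpha> * q\<close> and \<open>\<beta> * q\<close>, and the bound becomes
    \<open>(\<alpha> + \<beta>) * q \<le> 1\<close>.\<close>
  define q where "q = (s / S) powr (1 / n)"
  have q: "q > 0" "q ^ n = s / S"
    using S \<open>s > 0\<close> n by (auto simp: q_def powr_realpow[symmetric] powr_powr)
  have root: "(\<gamma> ^ n * s / S) powr (1 / n) = \<gamma> * q" if "\<gamma> > 0" for \<gamma>
  proof -
    have "(\<gamma> ^ n) powr (1 / n) = \<gamma>"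
      using that n by (simp add: powr_realpow[symmetric] powr_powr)
    then show ?thesis
      using that S \<open>s > 0\<close> by (simp add: q_def powr_mult flip: times_divide_eq_right)
  qed
  have am: "(\<Prod>i\<in>I. z i / (u i + w i)) powr (1 / n) \<le> (\<Sum>i\<in>I. z i / (u i + w i) / n)"
    if "\<And>i. i \<in> I \<Longrightarrow> z i > 0" for z
    unfolding n_def by (rule arith_geom_mean[OF I])
      (use that pos in \<open>force intro!: divide_nonneg_nonneg less_imp_le add_nonneg_nonneg\<close>)
  have "\<alpha> * q + \<beta> * q \<le> (\<Sum>i\<in>I. u i / (u i + w i) / n) + (\<Sum>i\<in>I. w i / (u i + w i) / n)"
    using am[of u] am[of w] pos root[OF \<open>\<alpha> > 0\<close>] root[OF \<open>\<beta> > 0\<close>]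
    by (simp add: prod_dividef u w n_def S_def)
  also have "\<dots> = (\<Sum>i\<in>I. 1 / n)"
    unfolding sum.distrib[symmetric]
  proof (rule sum.cong)
    fix i assume "i \<in> I"
    then have "u i + w i > 0"
      using pos by (simp add: add_pos_pos)
    then show "u i / (u i + w i) / n + w i / (u i + w i) / n = 1 / n"
      by (simp add: add_divide_distrib[symmetric])
  qed simp
  also have "\<dots> = 1"
    using n by (simp add: n_def)
  finally have "((\<alpha> + \<beta>) * q) ^ n \<le> 1"
    using \<open>\<alpha> > 0\<close> \<open>\<beta> > 0\<close> q by (intro power_le_one) (auto simp: algebra_simps)
  then have "(\<alpha> + \<beta>) ^ n * s / S \<le> 1"
    by (simp add: power_mult_distrib q)
  then show ?thesis
    using S by (simp add: n_def S_def field_simps)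
qed

lemma box_plus_box_subset:
  fixes a b c d :: "'a::euclidean_space"
  assumes "\<And>i. i \<in> Basis \<Longrightarrow> a \<bullet> i < b \<bullet> i" "\<And>i. i \<in> Basis \<Longrightarrow> c \<bullet> i < d \<bullet> i"
  shows "box (a + c) (b + d) \<subseteq> box a b + box c d"
proof
  fix z assume z: "z \<in> box (a + c) (b + d)"
  \<comment> \<open>The relative position of \<open>z\<close> in the large box along coordinate
    \<open>i\<close>. Both summands are placed at this same relative position in their own
    boxes.\<close>
  define r where "r i = (z \<bullet> i - a \<bullet> i - c \<bullet> i) / (b \<bullet> i - a \<bullet> i + (d \<bullet> i - c \<bullet> i))" for i
  define x where "x = (\<Sum>i\<in>Basis. (a \<bullet> i + r i * (b \<bullet> i - a \<bullet> i)) *\<^sub>R i)"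
  have xi: "x \<bullet> i = a \<bullet> i + r i * (b \<bullet> i - a \<bullet> i)" if "i \<in> Basis" for i
    using that by (simp add: x_def)
  have r: "0 < r i \<and> r i < 1 \<and> z \<bullet> i = a \<bullet> i + c \<bullet> i + r i * (b \<bullet> i - a \<bullet> i + (d \<bullet> i - c \<bullet> i))"
    if "i \<in> Basis" for i
    using z assms[OF that] that by (auto simp: r_def mem_box inner_add_left divide_simps)
  have "x \<in> box a b"
    using r assms by (simp add: mem_box xi)
       (smt (verit, best) mult_less_cancel_right2 mult_pos_pos)
  moreover have "z - x \<in> box c d"
    unfolding mem_box
  proof
    fix i :: 'a assume i: "i \<in> Basis"
    have eq: "(z - x) \<bullet> i = c \<bullet> i + r i * (d \<bullet> i - c \<bullet> i)"
      using r[OF i] by (simp add: inner_diff_left xi[OF i] algebra_simps)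
    have "0 < r i * (d \<bullet> i - c \<bullet> i)" "r i * (d \<bullet> i - c \<bullet> i) < 1 * (d \<bullet> i - c \<bullet> i)"
      using r[OF i] assms(2)[OF i] by (auto intro!: mult_strict_right_mono)
    then show "c \<bullet> i < (z - x) \<bullet> i \<and> (z - x) \<bullet> i < d \<bullet> i"
      unfolding eq by simp
  qed
  ultimately show "z \<in> box a b + box c d"
    by (metis add.commute diff_add_cancel set_plus_intro)
qed

lemma Brunn_Minkowski_box:
  fixes a b c d :: "'a::euclidean_space"
  assumes ne: "box a b \<noteq> {}" "box c d \<noteq> {}" and "\<alpha> > 0" "\<beta> > 0" "s > 0"
    and "measure lebesgue (box a b) = \<alpha> ^ DIM('a) * s"
    and "measure lebesgue (box c d) = \<beta> ^ DIM('a) * s"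
  shows "(\<alpha> + \<beta>) ^ DIM('a) * s \<le> measure lebesgue (box a b + box c d)"
proof -
  have lt: "a \<bullet> i < b \<bullet> i" "c \<bullet> i < d \<bullet> i" if "i \<in> Basis" for i
    using ne that by (auto simp: box_ne_empty)
  have "(\<alpha> + \<beta>) ^ DIM('a) * s \<le> (\<Prod>i\<in>Basis. (b \<bullet> i - a \<bullet> i) + (d \<bullet> i - c \<bullet> i))"
    using assms lt by (intro prod_add_ge) (auto simp: measure_box simp del: measure_completion)
  also have "\<dots> = measure lebesgue (box (a + c) (b + d))"
    using lt by (subst measure_box) (auto simp: inner_add_left add_strict_mono algebra_simps)
  also have "\<dots> \<le> measure lebesgue (box a b + box c d)"
    by (intro measure_mono_fmeasurable box_plus_box_subset lt)
      (auto intro!: lmeasurable_open open_set_plus bounded_set_plus)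
  finally show ?thesis .
qed

section \<open>Finite families of disjoint open boxes and their cuts by coordinate
  hyperplanes\<close>

text \<open>Open boxes make disjointness survive cutting by a hyperplane literally, at the price of losing
  only the null set on the hyperplane.\<close>

definition box_family :: "'a::euclidean_space set set \<Rightarrow> bool" where
  "box_family \<A> \<longleftrightarrow> finite \<A> \<and> \<A> \<noteq> {} \<and> pairwise disjnt \<A> \<and>
     (\<forall>X\<in>\<A>. X \<noteq> {} \<and> (\<exists>a b. X = box a b))"

lemma box_family_open: "box_family \<A> \<Longrightarrow> open (\<Union>\<A>)"
  by (force simp: box_family_def intro!: open_Union)

lemma box_family_bounded: "box_family \<A> \<Longrightarrow> bounded (\<Union>\<A>)"
  by (force simp: box_family_def intro!: bounded_Union)

lemma open_bounded_measure_pos: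
  fixes A :: "'a::euclidean_space set"
  assumes "open A" "bounded A" "A \<noteq> {}"
  shows "measure lebesgue A > 0"
  using assms open_not_negligible[of A] lmeasurable_open[of A]
  by (metis less_eq_real_def measure_nonneg negligible_iff_measure0)

lemma box_halfspace:
  fixes a b :: "'a::euclidean_space"
  assumes "k \<in> Basis"
  shows "\<exists>a' b'. box a b \<inter> {x. x \<bullet> k < c} = box a' b'"
    and "\<exists>a' b'. box a b \<inter> {x. x \<bullet> k > c} = box a' b'"
proof -
  have "box a b \<inter> {x. x \<bullet> k < c} =
      box a (\<Sum>i\<in>Basis. (if i = k then min (b \<bullet> k) c else b \<bullet> i) *\<^sub>R i)"
    using assms by (rule_tac set_eqI; auto simp: mem_box)+
  then show "\<exists>a' b'. box a b \<inter> {x. x \<bullet> k < c} = box a' b'"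
    by blast
  have "box a b \<inter> {x. x \<bullet> k > c} =
      box (\<Sum>i\<in>Basis. (if i = k then max (a \<bullet> k) c else a \<bullet> i) *\<^sub>R i) b"
    using assms by (rule_tac set_eqI; auto simp: mem_box)+
  then show "\<exists>a' b'. box a b \<inter> {x. x \<bullet> k > c} = box a' b'"
    by blast
qed

text \<open>The last conclusion is what makes the induction on the number of boxes descend: a box
  that misses \<open>H\<close> disappears from the family.\<close>

lemma box_family_restrict:
  assumes \<A>: "box_family \<A>" and H: "\<And>a b. \<exists>a' b'. box a b \<inter> H = box a' b'"
    and ne: "\<Union>\<A> \<inter> H \<noteq> {}"
  obtains \<A>' where "box_family \<A>'" "\<Union>\<A>' = \<Union>\<A> \<inter> H" "card \<A>' \<le> card \<A>"
    "\<And>X. X \<in> \<A> \<Longrightarrow> X \<inter> H = {} \<Longrightarrow> card \<A>' < card \<A>"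
proof
  let ?D = "{X \<in> \<A>. X \<inter> H \<noteq> {}}"
  let ?A = "(\<lambda>X. X \<inter> H) ` ?D"
  have fin: "finite \<A>"
    using \<A> by (auto simp: box_family_def)
  show "\<Union>?A = \<Union>\<A> \<inter> H"
    by auto
  show "box_family ?A"
    unfolding box_family_def
  proof (intro conjI ballI)
    show "pairwise disjnt ?A"
      using \<A> unfolding box_family_def pairwise_def disjnt_def by fastforce
    show "?A \<noteq> {}"
      using ne by auto
  qed (use \<A> H in \<open>auto simp: box_family_def\<close>)
  have le: "card ?A \<le> card ?D"
    using fin by (intro card_image_le) auto
  also have "\<dots> \<le> card \<A>"
    using fin by (intro card_mono) auto
  finally show "card ?A \<le> card \<A>" .
  show "card ?A < card \<A>" if "X \<in> \<A>" "X \<inter> H = {}" for X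
  proof -
    have "card ?D < card \<A>"
      using fin that by (intro psubset_card_mono) auto
    with le show ?thesis
      by simp
  qed
qed

text \<open>Moving the cut within distance \<open>d\<close> of \<open>c\<close> changes the measure
  by at most that of a slab inside a bounding box of \<open>B\<close>, and this is small for a thin
  slab.\<close>

lemma continuous_measure_halfspace:
  fixes B :: "'a::euclidean_space set"
  assumes B: "bounded B" "B \<in> sets lebesgue" and k: "k \<in> Basis"
  shows "continuous_on UNIV (\<lambda>c. measure lebesgue (B \<inter> {x. x \<bullet> k < c}))" (is "continuous_on UNIV ?F")
proof (simp add: continuous_on_eq_continuous_at, rule allI)
  fix c
  obtain a b where ab: "B \<subseteq> cbox a b"
    using B bounded_subset_cbox_symmetric by blast
  have H: "{x::'a. x \<bullet> k < c} \<in> sets lebesgue" for c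
    by (simp add: open_halfspace_component_lt borel_open)
  have meas: "B \<inter> {x. x \<bullet> k < c} \<in> lmeasurable" for c
    using B H by (intro bounded_set_imp_lmeasurable) auto
  show "isCont ?F c"
    unfolding continuous_at_eps_delta
  proof (intro allI impI)
    fix e :: real assume "e > 0"
    then obtain d where d: "d > 0" and less: "measure lborel (cbox a b \<inter> {x. \<bar>x \<bullet> k - c\<bar> \<le> d}) < e"
      using content_doublesplit[OF _ k] by metis
    let ?S = "cbox a b \<inter> {x. \<bar>x \<bullet> k - c\<bar> \<le> d}"
    have "closed {x. \<bar>x \<bullet> k - c\<bar> \<le> d}"
      by (intro closed_Collect_le continuous_intros)
    then have S: "?S \<in> lmeasurable"
      by (intro lmeasurable_compact compact_Int_closed) auto
    have less': "measure lebesgue ?S < e"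
      using less S by (simp add: fmeasurableD)
    have diff: "?F p \<le> ?F q + measure lebesgue ?S"
      if "\<bar>p - c\<bar> < d" "\<bar>q - c\<bar> < d" for p q
    proof -
      have "?F p \<le> measure lebesgue ((B \<inter> {x. x \<bullet> k < q}) \<union> ?S)"
        using ab that by (intro measure_mono_fmeasurable fmeasurable.Un meas S)
          (auto simp: fmeasurableD[OF meas] subset_iff abs_le_iff abs_less_iff)
      also have "\<dots> \<le> ?F q + measure lebesgue ?S"
        by (intro measure_Un_le fmeasurableD meas S)
      finally show ?thesis .
    qed
    show "\<exists>d>0. \<forall>x'. dist x' c < d \<longrightarrow> dist (?F x') (?F c) < e"
    proof (intro exI[of _ d] conjI allI impI)
      fix x' assume "dist x' c < d"
      then have "?F x' \<le> ?F c + measure lebesgue ?S" "?F c \<le> ?F x' + measure lebesgue ?S"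
        using d by (auto intro!: diff simp: dist_real_def simp del: measure_completion)
      then show "dist (?F x') (?F c) < e"
        using less' unfolding dist_real_def by linarith
    qed (rule d)
  qed
qed

lemma measure_split_hyperplane:
  fixes A :: "'a::euclidean_space set"
  assumes A: "A \<in> lmeasurable" and k: "k \<in> Basis"
  shows "measure lebesgue A =
    measure lebesgue (A \<inter> {x. x \<bullet> k < c}) + measure lebesgue (A \<inter> {x. x \<bullet> k > c})"
proof -
  have sets: "{x::'a. x \<bullet> k < c} \<in> sets lebesgue" "{x::'a. x \<bullet> k > c} \<in> sets lebesgue"
    by (simp_all add: open_halfspace_component_lt open_halfspace_component_gt borel_open)
  have N: "negligible {x::'a. x \<bullet> k = c}"
    by (rule negligible_standard_hyperplane[OF k])
  have "measure lebesgue A = measure lebesgue (A \<inter> {x. x \<bullet> k < c} \<union> A \<inter> {x. x \<bullet> k > c})"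
    by (rule measure_negligible_symdiff[OF A, symmetric], rule negligible_subset[OF N]) auto
  also have "\<dots> = measure lebesgue (A \<inter> {x. x \<bullet> k < c}) + measure lebesgue (A \<inter> {x. x \<bullet> k > c})"
  proof -
    have "(A \<inter> {x. x \<bullet> k < c}) \<inter> (A \<inter> {x. x \<bullet> k > c}) = {}"
      by auto
    then show ?thesis
      using A sets by (subst measure_Un3) (auto intro!: fmeasurable_Int_fmeasurable)
  qed
  finally show ?thesis .
qed

lemma bisect_hyperplane:
  fixes B :: "'a::euclidean_space set"
  assumes B: "bounded B" "B \<in> sets lebesgue" and k: "k \<in> Basis" and p: "0 \<le> p" "p \<le> measure lebesgue B"
  obtains c where "measure lebesgue (B \<inter> {x. x \<bullet> k < c}) = p"
proof -
  obtain a where a: "\<And>x. x \<in> B \<Longrightarrow> norm x \<le> a"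
    using B by (auto simp: bounded_iff)
  have low: "-a \<le> x \<bullet> k" "x \<bullet> k \<le> a" if "x \<in> B" for x
    using a[OF that] Basis_le_norm[OF k, of x] by auto
  \<comment> \<open>The upper end is \<open>\<bar>a\<bar> + 1\<close> so that the strict cut also
    takes in points with \<open>x \<bullet> k = \<bar>a\<bar>\<close>.\<close>
  have "B \<inter> {x. x \<bullet> k < - \<bar>a\<bar>} = {}" "B \<inter> {x. x \<bullet> k < \<bar>a\<bar> + 1} = B"
    using low by fastforce+
  then have "\<exists>c\<ge>-\<bar>a\<bar>. c \<le> \<bar>a\<bar> + 1 \<and> measure lebesgue (B \<inter> {x. x \<bullet> k < c}) = p"
    using p continuous_on_subset[OF continuous_measure_halfspace[OF B k] subset_UNIV]
    by (intro IVT') (auto simp del: measure_completion)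
  then show ?thesis
    using that by blast
qed

text \<open>Hadwiger--Ohmann: two disjoint boxes of \<open>\<A>\<close> are separated by a coordinate hyperplane, and a
  parallel hyperplane cuts \<open>\<Union>\<B>\<close> in the same proportion. The sums of corresponding pieces are
  disjoint and involve fewer boxes. The factor \<open>s\<close> is the proportion carried along by the induction.\<close>

lemma Brunn_Minkowski_boxes:
  fixes \<A> \<B> :: "'a::euclidean_space set set"
  assumes "box_family \<A>" "box_family \<B>" "\<alpha> > 0" "\<beta> > 0" "s > 0"
    and "measure lebesgue (\<Union>\<A>) = \<alpha> ^ DIM('a) * s"
    and "measure lebesgue (\<Union>\<B>) = \<beta> ^ DIM('a) * s"
  shows "(\<alpha> + \<beta>) ^ DIM('a) * s \<le> measure lebesgue (\<Union>\<A> + \<Union>\<B>)"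
  using assms
proof (induction "card \<A> + card \<B>" arbitrary: \<A> \<B> \<alpha> \<beta> s rule: less_induct)
  case less
  \<comment> \<open>Stated for arbitrary families with the same total number of boxes, so that it
    also applies with the roles of \<open>\<A>\<close> and \<open>\<B>\<close> exchanged.\<close>
  have step: "(\<alpha> + \<beta>) ^ DIM('a) * s \<le> measure lebesgue (\<Union>\<A>' + \<Union>\<B>')"
    if card: "card \<A>' + card \<B>' = card \<A> + card \<B>" and X: "X \<in> \<A>'" "Y \<in> \<A>'" "X \<noteq> Y"
      and fam: "box_family \<A>'" "box_family \<B>'" and pos: "\<alpha> > 0" "\<beta> > 0"
      and mA: "measure lebesgue (\<Union>\<A>') = \<alpha> ^ DIM('a) * s"
      and mB: "measure lebesgue (\<Union>\<B>') = \<beta> ^ DIM('a) * s"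
    for \<A>' \<B>' :: "'a set set" and X Y \<alpha> \<beta>
  proof -
    let ?A = "\<Union>\<A>'" and ?B = "\<Union>\<B>'"
    have "\<exists>a b c d. X = box a b \<and> Y = box c d" "X \<inter> Y = {}" and ne: "X \<noteq> {}" "Y \<noteq> {}"
      using fam X by (auto simp: box_family_def pairwise_def disjnt_def)
    then obtain a b c d where eq: "X = box a b" "Y = box c d" and disj: "box a b \<inter> box c d = {}"
      by blast
    have lt: "a \<bullet> i < b \<bullet> i" "c \<bullet> i < d \<bullet> i" if "i \<in> Basis" for i
      using ne that by (auto simp: eq box_ne_empty)
    obtain k where k: "k \<in> Basis" and "b \<bullet> k \<le> c \<bullet> k \<or> d \<bullet> k \<le> a \<bullet> k"
      using disj lt unfolding disjoint_interval by (metis not_le)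
    \<comment> \<open>\<open>U\<close> is whichever of the two boxes lies on the lower side of the
      separating hyperplane.\<close>
    then obtain r U V where U: "U \<in> \<A>'" "V \<in> \<A>'" "U \<subseteq> {x. x \<bullet> k < r}" "V \<subseteq> {x. x \<bullet> k > r}"
    proof (elim disjE)
      assume "b \<bullet> k \<le> c \<bullet> k"
      then show ?thesis
        using X k by (intro that[of X Y "b \<bullet> k"]) (force simp: eq mem_box)+
    next
      assume "d \<bullet> k \<le> a \<bullet> k"
      then show ?thesis
        using X k by (intro that[of Y X "d \<bullet> k"]) (force simp: eq mem_box)+
    qed
    let ?L = "\<lambda>t. {x::'a. x \<bullet> k < t}" and ?R = "\<lambda>t. {x::'a. x \<bullet> k > t}"
    have neU: "U \<noteq> {}" "V \<noteq> {}"
      using U fam by (auto simp: box_family_def)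
    have op: "open (?A \<inter> ?L t)" "open (?B \<inter> ?L t)" "open (?A \<inter> ?R t)" "open (?B \<inter> ?R t)" for t
      using fam by (auto intro!: open_Int box_family_open
          simp: open_halfspace_component_lt open_halfspace_component_gt)
    have bd: "bounded (?A \<inter> T)" "bounded (?B \<inter> T)" for T
      using box_family_bounded[OF fam(1)] box_family_bounded[OF fam(2)] by (auto intro: bounded_subset)
    have lm: "?A \<in> lmeasurable" "?B \<in> lmeasurable"
      using fam by (auto intro!: lmeasurable_open box_family_bounded box_family_open)
    have posA: "measure lebesgue (?A \<inter> ?L r) > 0" "measure lebesgue (?A \<inter> ?R r) > 0"
      using U neU by (auto intro!: open_bounded_measure_pos op bd simp del: measure_completion)
    define p where "p = measure lebesgue (?A \<inter> ?L r) / measure lebesgue ?A"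
    have sum: "measure lebesgue ?A = measure lebesgue (?A \<inter> ?L r) + measure lebesgue (?A \<inter> ?R r)"
      by (rule measure_split_hyperplane[OF lm(1) k])
    have p: "0 < p" "p < 1"
      using posA sum by (auto simp: p_def simp del: measure_completion)
    have ALR: "measure lebesgue (?A \<inter> ?L r) = \<alpha> ^ DIM('a) * (p * s)"
         "measure lebesgue (?A \<inter> ?R r) = \<alpha> ^ DIM('a) * ((1 - p) * s)"
    proof -
      have L: "measure lebesgue (?A \<inter> ?L r) = p * measure lebesgue ?A"
        using posA sum by (simp add: p_def del: measure_completion)
      then have "measure lebesgue (?A \<inter> ?R r) = (1 - p) * measure lebesgue ?A"
        using sum by (simp add: algebra_simps del: measure_completion)
      with L show "measure lebesgue (?A \<inter> ?L r) = \<alpha> ^ DIM('a) * (p * s)"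
         "measure lebesgue (?A \<inter> ?R r) = \<alpha> ^ DIM('a) * ((1 - p) * s)"
        by (simp_all add: mA del: measure_completion)
    qed
    obtain q where q: "measure lebesgue (?B \<inter> ?L q) = p * measure lebesgue ?B"
      using bisect_hyperplane[of ?B k "p * measure lebesgue ?B"] k lm(2) p fam(2)
      by (auto simp: box_family_bounded fmeasurableD mult_left_le_one_le simp del: measure_completion)
    have BLR: "measure lebesgue (?B \<inter> ?L q) = \<beta> ^ DIM('a) * (p * s)"
         "measure lebesgue (?B \<inter> ?R q) = \<beta> ^ DIM('a) * ((1 - p) * s)"
      using q mB measure_split_hyperplane[OF lm(2) k, of q]
      by (auto simp: algebra_simps simp del: measure_completion)
    have ps: "p * s > 0" "(1 - p) * s > 0"
      using p \<open>s > 0\<close> by auto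
    have neB: "?B \<inter> ?L q \<noteq> {}" "?B \<inter> ?R q \<noteq> {}"
      using BLR pos ps by (metis measure_empty mult_pos_pos order_less_irrefl zero_less_power)+
    \<comment> \<open>\<open>V\<close> misses the lower half-space and \<open>U\<close> the upper
      one, so each half of \<open>\<A>'\<close> has strictly fewer boxes. The halves of
      \<open>\<B>'\<close> have at most as many as before, hence the total drops.\<close>
    obtain \<A>1 where A1: "box_family \<A>1" "\<Union>\<A>1 = ?A \<inter> ?L r" "card \<A>1 < card \<A>'"
    proof (rule box_family_restrict[OF fam(1) box_halfspace(1)[OF k]])
      show "?A \<inter> ?L r \<noteq> {}" using U neU by auto
    qed (use U in fastforce)
    obtain \<A>2 where A2: "box_family \<A>2" "\<Union>\<A>2 = ?A \<inter> ?R r" "card \<A>2 < card \<A>'"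
    proof (rule box_family_restrict[OF fam(1) box_halfspace(2)[OF k]])
      show "?A \<inter> ?R r \<noteq> {}" using U neU by auto
    qed (use U in fastforce)
    obtain \<B>1 where B1: "box_family \<B>1" "\<Union>\<B>1 = ?B \<inter> ?L q" "card \<B>1 \<le> card \<B>'"
      using box_family_restrict[OF fam(2) box_halfspace(1)[OF k] neB(1)] by metis
    obtain \<B>2 where B2: "box_family \<B>2" "\<Union>\<B>2 = ?B \<inter> ?R q" "card \<B>2 \<le> card \<B>'"
      using box_family_restrict[OF fam(2) box_halfspace(2)[OF k] neB(2)] by metis
    let ?S1 = "?A \<inter> ?L r + ?B \<inter> ?L q" and ?S2 = "?A \<inter> ?R r + ?B \<inter> ?R q"
    have S1: "(\<alpha> + \<beta>) ^ DIM('a) * (p * s) \<le> measure lebesgue ?S1"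
      using less.hyps[of \<A>1 \<B>1 \<alpha> \<beta> "p * s"] A1 B1 card pos ps ALR BLR by simp
    have S2: "(\<alpha> + \<beta>) ^ DIM('a) * ((1 - p) * s) \<le> measure lebesgue ?S2"
      using less.hyps[of \<A>2 \<B>2 \<alpha> \<beta> "(1 - p) * s"] A2 B2 card pos ps ALR BLR by simp
    have lmS: "?S1 \<in> lmeasurable" "?S2 \<in> lmeasurable"
      by (intro lmeasurable_open open_set_plus bounded_set_plus op bd)+
    have lmAB: "?A + ?B \<in> lmeasurable"
      using fam by (intro lmeasurable_open open_set_plus bounded_set_plus box_family_bounded box_family_open)
    have "(\<alpha> + \<beta>) ^ DIM('a) * s \<le> measure lebesgue ?S1 + measure lebesgue ?S2"
      using S1 S2 by (simp add: algebra_simps)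
    also have "\<dots> = measure lebesgue (?S1 \<union> ?S2)"
    proof (rule measure_Un3[THEN trans, symmetric])
      \<comment> \<open>Cuts at heights \<open>r\<close> and \<open>q\<close> put the two partial
        sums on opposite sides of height \<open>r + q\<close>.\<close>
      have "?S1 \<subseteq> {x. x \<bullet> k < r + q}" "?S2 \<subseteq> {x. x \<bullet> k > r + q}"
        by (auto simp: inner_add_left add_strict_mono elim!: set_plus_elim)
      then have "?S1 \<inter> ?S2 = {}"
        by fastforce
      then show "measure lebesgue ?S1 + measure lebesgue ?S2 - measure lebesgue (?S1 \<inter> ?S2) =
          measure lebesgue ?S1 + measure lebesgue ?S2"
        by simp
    qed (use lmS in auto)
    also have "\<dots> \<le> measure lebesgue (?A + ?B)"
      using lmS lmAB by (intro measure_mono_fmeasurable) (auto simp: set_plus_def)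
    finally show ?thesis .
  qed
  consider X Y where "X \<in> \<A>" "Y \<in> \<A>" "X \<noteq> Y" | X Y where "X \<in> \<B>" "Y \<in> \<B>" "X \<noteq> Y"
    | X Y where "\<A> = {X}" "\<B> = {Y}"
  proof -
    have "\<exists>X. \<C> = {X}" if \<C>: "box_family \<C>" "\<forall>X\<in>\<C>. \<forall>Y\<in>\<C>. X = Y" for \<C> :: "'a set set"
    proof -
      obtain X where "X \<in> \<C>"
        using \<C>(1) unfolding box_family_def by blast
      then have "\<C> = {X}"
        using \<C>(2) by blast
      then show ?thesis ..
    qed
    then show ?thesis
      using that less.prems(1,2) by metis
  qed
  then show ?case
  proof cases
    case 1
    then show ?thesis
      using less.prems by (intro step) auto
  next
    case 2
    have "(\<beta> + \<alpha>) ^ DIM('a) * s \<le> measure lebesgue (\<Union>\<B> + \<Union>\<A>)"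
      using less.prems 2 by (intro step) auto
    then show ?thesis
      by (simp add: add.commute)
  next
    case 3
    have "\<exists>a b. X = box a b" "\<exists>c d. Y = box c d" and ne: "X \<noteq> {}" "Y \<noteq> {}"
      using less.prems(1,2) unfolding box_family_def 3 by simp_all
    then obtain a b c d where "X = box a b" "Y = box c d"
      by metis
    with ne show ?thesis
      using Brunn_Minkowski_box[of a b c d \<alpha> \<beta> s] less.prems 3 by simp
  qed
qed

section \<open>Passage from box families to open sets and to compact convex sets\<close>

lemma open_box_family_approx:
  fixes A :: "'a::euclidean_space set"
  assumes A: "open A" "bounded A" and m: "0 \<le> m" "m < measure lebesgue A"
  obtains \<A> where "box_family \<A>" "\<Union>\<A> \<subseteq> A" "m < measure lebesgue (\<Union>\<A>)"
proof -
  obtain a where a: "A \<subseteq> cbox (-a) a"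
    using A bounded_subset_cbox_symmetric by blast
  have ne: "A \<noteq> {}"
    using m by auto
  then have "interior (cbox (-a) a) \<noteq> {}"
    using a A by (metis interior_maximal subset_empty)
  then have ba: "box (-a) a \<noteq> {}"
    by simp
  \<comment> \<open>With this gauge every cell of the covering contains a point of \<open>A\<close>
    and so lies inside \<open>A\<close>. The countably many cells then fill \<open>A\<close>
    exactly, and finitely many of them already have measure above \<open>m\<close>.\<close>
  have g: "gauge (\<lambda>x. if x \<in> A then A else UNIV)"
    using A by (auto simp: gauge_def)
  obtain \<D> where D: "countable \<D>"
    "\<And>K. K \<in> \<D> \<Longrightarrow> interior K \<noteq> {} \<and> (\<exists>c d. K = cbox c d)"
    "pairwise (\<lambda>A B. interior A \<inter> interior B = {}) \<D>"
    "\<And>K. K \<in> \<D> \<Longrightarrow> \<exists>x \<in> A \<inter> K. K \<subseteq> (if x \<in> A then A else UNIV)"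
    "A \<subseteq> \<Union>\<D>"
    by (rule covering_lemma[OF a ba g]) (rule that; assumption)
  have sub: "K \<subseteq> A" if "K \<in> \<D>" for K
    using D(4)[OF that] by auto
  have eq: "\<Union>\<D> = A"
    using sub D(5) by (intro equalityI Sup_least)
  have "\<D> \<noteq> {}"
    using ne eq by auto
  \<comment> \<open>The enumeration may repeat cells, but unequal interiors always come from unequal
    cells.\<close>
  define D where "D = from_nat_into \<D>"
  have ran: "range D = \<D>"
    unfolding D_def by (rule range_from_nat_into[OF \<open>\<D> \<noteq> {}\<close> D(1)])
  have in_D: "D i \<in> \<D>" for i
    using ran by auto
  have lmD: "D i \<in> lmeasurable" for i
    using D(2)[OF in_D[of i]] by auto
  have UN: "(\<Union>n. \<Union>i<n. D i) = A"
  proof -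
    have "(\<Union>n. \<Union>i<n. D i) = \<Union>(range D)"
      by auto
    then show ?thesis
      unfolding ran eq .
  qed
  have "(\<lambda>n. measure lebesgue (\<Union>i<n. D i)) \<longlonglongrightarrow> measure lebesgue (\<Union>n. \<Union>i<n. D i)"
  proof (rule Lim_measure_incseq)
    show "range (\<lambda>n. \<Union>i<n. D i) \<subseteq> sets lebesgue"
      using lmD by (auto dest: fmeasurableD)
    show "incseq (\<lambda>n. \<Union>i<n. D i)"
      by (force simp: incseq_def)
    show "emeasure lebesgue (\<Union>n. \<Union>i<n. D i) \<noteq> \<infinity>"
      using lmeasurable_open[OF A(2,1)] UN by (auto simp: fmeasurable_def)
  qed
  then have "\<forall>\<^sub>F n in sequentially. m < measure lebesgue (\<Union>i<n. D i)"
    using m(2) unfolding UN by (rule order_tendstoD(1))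
  then obtain n where n: "m < measure lebesgue (\<Union>i<n. D i)"
    by (auto simp: eventually_sequentially)
  let ?A = "(\<lambda>K. interior K) ` D ` {..<n}"
  show ?thesis
  proof
    show "box_family ?A"
      unfolding box_family_def
    proof (intro conjI ballI)
      show "?A \<noteq> {}"
        using n m by (cases n) auto
      show "pairwise disjnt ?A"
      proof (rule pairwiseI)
        fix X Y assume "X \<in> ?A" "Y \<in> ?A" "X \<noteq> Y"
        then obtain i j where ij: "X = interior (D i)" "Y = interior (D j)"
          by blast
        with \<open>X \<noteq> Y\<close> have "D i \<noteq> D j"
          by metis
        then show "disjnt X Y"
          using pairwiseD[OF D(3) in_D in_D] by (simp add: ij disjnt_def)
      qed
      fix X assume "X \<in> ?A"
      then obtain K where "K \<in> \<D>" "X = interior K"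
        using in_D by auto
      then show "X \<noteq> {}" "\<exists>a b. X = box a b"
        using D(2)[of K] by (metis interior_cbox)+
    qed simp
    show "\<Union>?A \<subseteq> A"
      by (intro Union_least) (use sub[OF in_D] in \<open>auto dest: interior_subset[THEN subsetD]\<close>)
    \<comment> \<open>Replacing closed cells by their interiors loses only points of finitely many
      negligible frontiers.\<close>
    have "measure lebesgue (\<Union>i<n. D i) = measure lebesgue (\<Union>?A)"
    proof (rule measure_negligible_symdiff[symmetric])
      show "(\<Union>i<n. D i) \<in> lmeasurable"
        using lmD by (intro fmeasurable.finite_UN) auto
      have "negligible (\<Union>i<n. frontier (D i))"
      proof (rule negligible_Union)
        have "negligible (frontier (D i))" for i
          using D(2)[OF in_D[of i]] negligible_convex_frontier[OF convex_box(1)] by metis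
        then show "negligible T" if "T \<in> (\<lambda>i. frontier (D i)) ` {..<n}" for T
          using that by auto
      qed simp
      then show "negligible (sym_diff (\<Union>i<n. D i) (\<Union>?A))"
      proof (rule negligible_subset, intro subsetI)
        fix x assume "x \<in> sym_diff (\<Union>i<n. D i) (\<Union>?A)"
        then obtain i where "i < n" "x \<in> D i" "x \<notin> interior (D i)"
          using interior_subset by blast
        then show "x \<in> (\<Union>i<n. frontier (D i))"
          using closure_subset[of "D i"] by (auto simp: frontier_def)
      qed
    qed
    then show "m < measure lebesgue (\<Union>?A)"
      using n by simp
  qed
qed

text \<open>Both sets are approximated from inside by box families whose volumes exceed those of the
  copies scaled by \<open>\<eta> < 1\<close>. Letting \<open>\<eta>\<close> tend to 1 gives the
  bound.\<close>

lemma Brunn_Minkowski_open: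
  fixes A B :: "'a::euclidean_space set"
  assumes A: "open A" "bounded A" "measure lebesgue A = \<alpha> ^ DIM('a)"
    and B: "open B" "bounded B" "measure lebesgue B = \<beta> ^ DIM('a)"
    and pos: "\<alpha> > 0" "\<beta> > 0"
  shows "(\<alpha> + \<beta>) ^ DIM('a) \<le> measure lebesgue (A + B)"
proof -
  have approx: "(\<eta> * (\<alpha> + \<beta>)) ^ DIM('a) \<le> measure lebesgue (A + B)" if \<eta>: "0 < \<eta>" "\<eta> < 1" for \<eta>
  proof -
    have less: "(\<eta> * \<gamma>) ^ DIM('a) < \<gamma> ^ DIM('a)" if "\<gamma> > 0" for \<gamma>
      using \<eta> that by (intro power_strict_mono) auto
    obtain \<A> where \<A>: "box_family \<A>" "\<Union>\<A> \<subseteq> A" "(\<eta> * \<alpha>) ^ DIM('a) < measure lebesgue (\<Union>\<A>)"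
      using open_box_family_approx[OF A(1,2), of "(\<eta> * \<alpha>) ^ DIM('a)"] less A \<eta> pos by auto
    obtain \<B> where \<B>: "box_family \<B>" "\<Union>\<B> \<subseteq> B" "(\<eta> * \<beta>) ^ DIM('a) < measure lebesgue (\<Union>\<B>)"
      using open_box_family_approx[OF B(1,2), of "(\<eta> * \<beta>) ^ DIM('a)"] less B \<eta> pos by auto
    define \<alpha>' where "\<alpha>' = root DIM('a) (measure lebesgue (\<Union>\<A>))"
    define \<beta>' where "\<beta>' = root DIM('a) (measure lebesgue (\<Union>\<B>))"
    have pow: "\<alpha>' ^ DIM('a) = measure lebesgue (\<Union>\<A>)" "\<beta>' ^ DIM('a) = measure lebesgue (\<Union>\<B>)"
      by (simp_all add: \<alpha>'_def \<beta>'_def)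
    have ge: "\<eta> * \<alpha> < \<alpha>'" "\<eta> * \<beta> < \<beta>'"
      using \<A>(3) \<B>(3) by (auto intro!: power_less_imp_less_base[where n = "DIM('a)"]
          simp: pow[symmetric] simp del: measure_completion) (simp_all add: \<alpha>'_def \<beta>'_def)
    have "\<eta> * \<alpha> > 0" "\<eta> * \<beta> > 0"
      using \<eta> pos by auto
    then have "\<alpha>' > 0" "\<beta>' > 0"
      using ge by linarith+
    have "(\<eta> * (\<alpha> + \<beta>)) ^ DIM('a) \<le> (\<alpha>' + \<beta>') ^ DIM('a)"
      using ge \<eta> pos by (intro power_mono) (auto simp: algebra_simps)
    also have "\<dots> \<le> measure lebesgue (\<Union>\<A> + \<Union>\<B>)"
      using Brunn_Minkowski_boxes[OF \<A>(1) \<B>(1) \<open>\<alpha>' > 0\<close> \<open>\<beta>' > 0\<close>, of 1] pow by simp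
    also have "\<dots> \<le> measure lebesgue (A + B)"
      using \<A> \<B> A B by (intro measure_mono_fmeasurable fmeasurableD lmeasurable_open bounded_set_plus
          open_set_plus set_plus_mono2 box_family_open box_family_bounded)
    finally show ?thesis .
  qed
  have "((\<lambda>\<eta>. (\<eta> * (\<alpha> + \<beta>)) ^ DIM('a)) \<longlongrightarrow> (1 * (\<alpha> + \<beta>)) ^ DIM('a)) (at_left 1)"
    by (intro tendsto_intros)
  moreover have "\<forall>\<^sub>F \<eta> in at_left (1::real). (\<eta> * (\<alpha> + \<beta>)) ^ DIM('a) \<le> measure lebesgue (A + B)"
    using eventually_at_left_real[of 0 "1::real"] by (auto elim!: eventually_mono intro!: approx)
  ultimately show ?thesis
    using tendsto_upperbound trivial_limit_at_left_real by fastforce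
qed

theorem Brunn_Minkowski_convex:
  fixes A B :: "'a::euclidean_space set"
  assumes A: "compact A" "convex A" "A \<noteq> {}" "measure lebesgue A = \<alpha> ^ DIM('a)"
    and B: "compact B" "convex B" "B \<noteq> {}" "measure lebesgue B = \<beta> ^ DIM('a)"
    and nonneg: "\<alpha> \<ge> 0" "\<beta> \<ge> 0"
  shows "(\<alpha> + \<beta>) ^ DIM('a) \<le> measure lebesgue (A + B)"
proof -
  have lm: "A + B \<in> lmeasurable"
    using A B by (intro lmeasurable_compact compact_set_plus)
  \<comment> \<open>A Minkowski sum contains a translate of each summand, which settles the cases of
    volume zero.\<close>
  have shift: "measure lebesgue D \<le> measure lebesgue (C + D)"
    if "c \<in> C" "compact C" "compact D" for c and C D :: "'a set"
  proof -
    have "measure lebesgue D = measure lebesgue ((+) c ` D)"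
      by (simp only: measure_translation)
    also have "\<dots> \<le> measure lebesgue (C + D)"
      using that by (intro measure_mono_fmeasurable fmeasurableD lmeasurable_compact
          compact_set_plus compact_translation) (auto simp: set_plus_def)
    finally show ?thesis .
  qed
  consider "\<alpha> = 0" | "\<beta> = 0" | "\<alpha> > 0" "\<beta> > 0"
    using nonneg by linarith
  then show ?thesis
  proof cases
    case 1
    then show ?thesis
      using shift[of _ A B] A B by auto
  next
    case 2
    then show ?thesis
      using shift[of _ B A] A B by (auto simp: add.commute)
  next
    case 3
    have int: "measure lebesgue (interior C) = measure lebesgue C" if "compact C" "convex C" for C :: "'a set"
      using that
      by (intro measure_negligible_symdiff negligible_subset[OF negligible_convex_frontier[OF that(2)]])
        (auto simp: lmeasurable_compact frontier_def closure_closed compact_imp_closed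
              dest: interior_subset[THEN subsetD])
    have "(\<alpha> + \<beta>) ^ DIM('a) \<le> measure lebesgue (interior A + interior B)"
      using 3 A B int by (intro Brunn_Minkowski_open) (auto simp: bounded_interior compact_imp_bounded
         simp del: measure_completion)
    also have "\<dots> \<le> measure lebesgue (A + B)"
      using A B by (intro measure_mono_fmeasurable lm set_plus_mono2 interior_subset fmeasurableD
          lmeasurable_open open_set_plus bounded_set_plus open_interior bounded_interior compact_imp_bounded)
    finally show ?thesis .
  qed
qed

section \<open>Volumes of parallel slices\<close>

text \<open>The points with \<open>v \<bullet> x \<in> {0..l}\<close> whose orthogonal translate to the hyperplane at height \<open>t\<close> lies
  in \<open>K\<close>: the cylinder of length \<open>l\<close> over the slice of \<open>K\<close> at height \<open>t\<close>, moved to start at height 0.\<close>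

definition slice_cylinder :: "'a::euclidean_space \<Rightarrow> 'a set \<Rightarrow> real \<Rightarrow> real \<Rightarrow> 'a set" where
  "slice_cylinder v K t l = {x. v \<bullet> x \<in> {0..l} \<and> x + (t - v \<bullet> x) *\<^sub>R v \<in> K}"

definition slice_vol :: "'a::euclidean_space \<Rightarrow> 'a set \<Rightarrow> real \<Rightarrow> real" where
  "slice_vol v K t = measure lebesgue (slice_cylinder v K t 1)"

lemma slice_vol_nonneg: "slice_vol v K t \<ge> 0"
  by (simp add: slice_vol_def)

lemma compact_slice_cylinder:
  fixes v :: "'a::euclidean_space"
  assumes v: "norm v = 1" and K: "compact K"
  shows "compact (slice_cylinder v K t l)"
proof -
  have "closed (slice_cylinder v K t l)"
  proof -
    have "closed ((\<lambda>x. v \<bullet> x) -` {0..l} \<inter> (\<lambda>x. x + (t - v \<bullet> x) *\<^sub>R v) -` K)"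
      using K by (intro closed_Int closed_vimage continuous_intros) (auto intro: compact_imp_closed)
    then show ?thesis
      by (simp add: slice_cylinder_def vimage_def Int_def)
  qed
  moreover have "bounded (slice_cylinder v K t l)"
  proof -
    obtain b where b: "\<And>y. y \<in> K \<Longrightarrow> norm y \<le> b"
      using compact_imp_bounded[OF K] by (auto simp: bounded_iff)
    have "norm x \<le> b + \<bar>t\<bar> + \<bar>l\<bar>" if "x \<in> slice_cylinder v K t l" for x
    proof -
      let ?y = "x + (t - v \<bullet> x) *\<^sub>R v"
      have "norm x = norm (?y - (t - v \<bullet> x) *\<^sub>R v)"
        by simp
      also have "\<dots> \<le> norm ?y + \<bar>t - v \<bullet> x\<bar>"
        using norm_triangle_ineq4[of ?y "(t - v \<bullet> x) *\<^sub>R v"] v by simp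
      also have "\<dots> \<le> b + (\<bar>t\<bar> + \<bar>l\<bar>)"
        using that b[of ?y] by (intro add_mono) (auto simp: slice_cylinder_def)
      finally show ?thesis
        by simp
    qed
    then show ?thesis
      by (auto simp: bounded_iff)
  qed
  ultimately show ?thesis
    by (simp add: compact_eq_bounded_closed)
qed

lemma convex_slice_cylinder:
  assumes "convex K"
  shows "convex (slice_cylinder v K t l)"
proof (rule convexI)
  fix x y u w assume x: "x \<in> slice_cylinder v K t l" and y: "y \<in> slice_cylinder v K t l"
    and uw: "0 \<le> (u::real)" "0 \<le> w" "u + w = 1"
  have "u *\<^sub>R (v \<bullet> x) + w *\<^sub>R (v \<bullet> y) \<in> {0..l}"
    using x y uw by (intro convexD convex_real_interval) (auto simp: slice_cylinder_def)
  moreover have "u *\<^sub>R (x + (t - v \<bullet> x) *\<^sub>R v) + w *\<^sub>R (y + (t - v \<bullet> y) *\<^sub>R v) \<in> K"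
    using x y uw by (intro convexD[OF assms]) (auto simp: slice_cylinder_def)
  moreover have "u *\<^sub>R (x + (t - v \<bullet> x) *\<^sub>R v) + w *\<^sub>R (y + (t - v \<bullet> y) *\<^sub>R v) =
      (u *\<^sub>R x + w *\<^sub>R y) + ((u + w) * t - v \<bullet> (u *\<^sub>R x + w *\<^sub>R y)) *\<^sub>R v"
    by (simp add: algebra_simps inner_add_right)
  ultimately show "u *\<^sub>R x + w *\<^sub>R y \<in> slice_cylinder v K t l"
    using uw by (simp add: slice_cylinder_def inner_add_right)
qed

section \<open>Integration over the slices\<close>

lemma nn_integral_lborel_translation:
  fixes g :: "'a::euclidean_space \<Rightarrow> ennreal"
  assumes [measurable]: "g \<in> borel_measurable borel"
  shows "(\<integral>\<^sup>+x. g x \<partial>lborel) = (\<integral>\<^sup>+x. g (c + x) \<partial>lborel)"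
proof -
  have "(\<integral>\<^sup>+x. g x \<partial>lborel) = (\<integral>\<^sup>+x. g x \<partial>distr lborel borel ((+) c))"
    by (simp add: lborel_distr_plus)
  also have "\<dots> = (\<integral>\<^sup>+x. g (c + x) \<partial>lborel)"
    by (subst nn_integral_distr) auto
  finally show ?thesis .
qed

lemma sets_slice_cylinder [measurable]:
  assumes [measurable]: "K \<in> sets borel"
  shows "slice_cylinder v K t l \<in> sets borel"
  unfolding slice_cylinder_def by measurable

text \<open>Fubini along \<open>v\<close> without splitting the space: integrate over heights and cylinder points
  jointly and shift each variable by the other, using translation invariance only.\<close>

lemma nn_integral_slices:
  fixes v :: "'a::euclidean_space" and f :: "real \<Rightarrow> ennreal"
  assumes v: "norm v = 1" and [measurable]: "K \<in> sets borel" "f \<in> borel_measurable borel"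
  shows "(\<integral>\<^sup>+t. f t * emeasure lborel (slice_cylinder v K t 1) \<partial>lborel) =
         (\<integral>\<^sup>+y. f (v \<bullet> y) * indicator K y \<partial>lborel)"
proof -
  have vv: "v \<bullet> v = 1"
    using v by (simp add: norm_eq_1)
  have "(\<integral>\<^sup>+t. f t * emeasure lborel (slice_cylinder v K t 1) \<partial>lborel) =
    (\<integral>\<^sup>+t. (\<integral>\<^sup>+x. f t * indicator K (x + (t - v \<bullet> x) *\<^sub>R v) * indicator {0..1} (v \<bullet> x) \<partial>lborel) \<partial>lborel)"
  proof (rule nn_integral_cong)
    fix t :: real
    have "f t * emeasure lborel (slice_cylinder v K t 1) =
        (\<integral>\<^sup>+x. f t * indicator (slice_cylinder v K t 1) x \<partial>lborel)"
      by (simp add: nn_integral_cmult)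
    also have "\<dots> = (\<integral>\<^sup>+x. f t * indicator K (x + (t - v \<bullet> x) *\<^sub>R v) * indicator {0..1} (v \<bullet> x) \<partial>lborel)"
      by (intro nn_integral_cong) (auto simp: slice_cylinder_def indicator_def)
    finally show "f t * emeasure lborel (slice_cylinder v K t 1) = \<dots>" .
  qed
  also have "\<dots> = (\<integral>\<^sup>+x. (\<integral>\<^sup>+t. f t * indicator K (x + (t - v \<bullet> x) *\<^sub>R v) * indicator {0..1} (v \<bullet> x) \<partial>lborel) \<partial>lborel)"
    by (rule lborel_pair.Fubini') measurable
  \<comment> \<open>The substitution \<open>t = v \<bullet> x + u\<close> makes the displacement
    along \<open>v\<close> independent of \<open>x\<close>.\<close>
  also have "\<dots> = (\<integral>\<^sup>+x. (\<integral>\<^sup>+u. f (v \<bullet> x + u) * indicator K (x + u *\<^sub>R v) * indicator {0..1} (v \<bullet> x) \<partial>lborel) \<partial>lborel)"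
  proof (rule nn_integral_cong)
    fix x :: 'a
    show "(\<integral>\<^sup>+t. f t * indicator K (x + (t - v \<bullet> x) *\<^sub>R v) * indicator {0..1} (v \<bullet> x) \<partial>lborel) =
      (\<integral>\<^sup>+u. f (v \<bullet> x + u) * indicator K (x + u *\<^sub>R v) * indicator {0..1} (v \<bullet> x) \<partial>lborel)"
      by (subst nn_integral_lborel_translation[where c = "v \<bullet> x"]) auto
  qed
  also have "\<dots> = (\<integral>\<^sup>+u. (\<integral>\<^sup>+x. f (v \<bullet> x + u) * indicator K (x + u *\<^sub>R v) * indicator {0..1} (v \<bullet> x) \<partial>lborel) \<partial>lborel)"
    by (rule lborel_pair.Fubini') measurable
  \<comment> \<open>Substituting \<open>x = y - u *\<^sub>R v\<close> turns the height condition on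
    \<open>x\<close> into membership of \<open>u\<close> in an interval of length 1, so the integral
    over \<open>u\<close> contributes the factor 1.\<close>
  also have "\<dots> = (\<integral>\<^sup>+u. (\<integral>\<^sup>+y. f (v \<bullet> y) * indicator K y * indicator {v \<bullet> y - 1..v \<bullet> y} u \<partial>lborel) \<partial>lborel)"
  proof (rule nn_integral_cong)
    fix u :: real
    have "(\<integral>\<^sup>+x. f (v \<bullet> x + u) * indicator K (x + u *\<^sub>R v) * indicator {0..1} (v \<bullet> x) \<partial>lborel) =
      (\<integral>\<^sup>+y. f (v \<bullet> (- u *\<^sub>R v + y) + u) * indicator K (- u *\<^sub>R v + y + u *\<^sub>R v) *
          indicator {0..1} (v \<bullet> (- u *\<^sub>R v + y)) \<partial>lborel)"
      by (subst nn_integral_lborel_translation[where c = "- u *\<^sub>R v"]) auto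
    also have "\<dots> = (\<integral>\<^sup>+y. f (v \<bullet> y) * indicator K y * indicator {v \<bullet> y - 1..v \<bullet> y} u \<partial>lborel)"
      by (intro nn_integral_cong) (auto simp: inner_diff_right vv indicator_def)
    finally show "(\<integral>\<^sup>+x. f (v \<bullet> x + u) * indicator K (x + u *\<^sub>R v) * indicator {0..1} (v \<bullet> x) \<partial>lborel) = \<dots>" .
  qed
  also have "\<dots> = (\<integral>\<^sup>+y. (\<integral>\<^sup>+u. f (v \<bullet> y) * indicator K y * indicator {v \<bullet> y - 1..v \<bullet> y} u \<partial>lborel) \<partial>lborel)"
    unfolding indicator_def atLeastAtMost_iff by (rule lborel_pair.Fubini') measurable
  also have "\<dots> = (\<integral>\<^sup>+y. f (v \<bullet> y) * indicator K y \<partial>lborel)"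
    by (intro nn_integral_cong) (simp add: nn_integral_cmult)
  finally show ?thesis .
qed

lemma emeasure_slice_cylinder:
  assumes v: "norm v = 1" and K: "compact K"
  shows "emeasure lborel (slice_cylinder v K t 1) = ennreal (slice_vol v K t)"
proof -
  have c: "compact (slice_cylinder v K t 1)"
    by (rule compact_slice_cylinder[OF v K])
  show ?thesis
    using fmeasurable_compact[OF c] borel_compact[OF c] emeasure_compact_finite[OF c]
    by (simp add: slice_vol_def emeasure_eq_ennreal_measure less_top[symmetric])
qed

lemma borel_measurable_slice_vol [measurable]:
  fixes v :: "'a::euclidean_space"
  assumes v: "norm v = 1" and K: "compact K"
  shows "slice_vol v K \<in> borel_measurable borel"
proof -
  have [measurable]: "K \<in> sets borel"
    using K by (rule borel_compact)
  have "(\<lambda>t. \<integral>\<^sup>+x. indicator K (x + (t - v \<bullet> x) *\<^sub>R v) * indicator {0..1} (v \<bullet> x) \<partial>lborel)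
      \<in> borel_measurable borel"
    by measurable
  also have "(\<lambda>t. \<integral>\<^sup>+x. indicator K (x + (t - v \<bullet> x) *\<^sub>R v) * indicator {0..1} (v \<bullet> x) \<partial>lborel) =
      (\<lambda>t. ennreal (slice_vol v K t))"
  proof
    fix t
    have "(\<integral>\<^sup>+x. indicator K (x + (t - v \<bullet> x) *\<^sub>R v) * indicator {0..1} (v \<bullet> x) \<partial>lborel) =
      (\<integral>\<^sup>+x. indicator (slice_cylinder v K t 1) x \<partial>lborel)"
      by (intro nn_integral_cong) (auto simp: slice_cylinder_def indicator_def)
    then show "(\<integral>\<^sup>+x. indicator K (x + (t - v \<bullet> x) *\<^sub>R v) * indicator {0..1} (v \<bullet> x) \<partial>lborel) =
      ennreal (slice_vol v K t)"
      by (simp add: emeasure_slice_cylinder[OF v K])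
  qed
  finally have "(\<lambda>t. enn2real (ennreal (slice_vol v K t))) \<in> borel_measurable borel"
    by measurable
  then show ?thesis
    by (simp add: slice_vol_nonneg)
qed

text \<open>The nonnegative case comes from \<open>nn_integral_slices\<close>. The signed case,
  needed for the first moment, follows by splitting \<open>f\<close> into positive and negative
  parts.\<close>

lemma has_bochner_integral_slices:
  fixes v :: "'a::euclidean_space" and f :: "real \<Rightarrow> real"
  assumes v: "norm v = 1" and K: "compact K" and f [measurable]: "f \<in> borel_measurable borel"
    and int: "integrable lborel (\<lambda>y. f (v \<bullet> y) * indicator K y)"
  shows "has_bochner_integral lborel (\<lambda>t. f t * slice_vol v K t) (\<integral>y. f (v \<bullet> y) * indicator K y \<partial>lborel)"
proof -
  have [measurable]: "K \<in> sets borel" "slice_vol v K \<in> borel_measurable borel"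
    using K v by (auto simp: borel_compact borel_measurable_slice_vol)
  have nonneg: "has_bochner_integral lborel (\<lambda>t. g t * slice_vol v K t) (\<integral>y. g (v \<bullet> y) * indicator K y \<partial>lborel)"
    if [measurable]: "g \<in> borel_measurable borel" and g: "\<And>t. g t \<ge> 0"
      and "integrable lborel (\<lambda>y. g (v \<bullet> y) * indicator K y)" for g :: "real \<Rightarrow> real"
  proof (rule has_bochner_integral_nn_integral)
    have "(\<integral>\<^sup>+t. ennreal (g t * slice_vol v K t) \<partial>lborel) =
        (\<integral>\<^sup>+t. ennreal (g t) * emeasure lborel (slice_cylinder v K t 1) \<partial>lborel)"
      using g by (simp add: emeasure_slice_cylinder[OF v K] ennreal_mult slice_vol_nonneg)
    also have "\<dots> = (\<integral>\<^sup>+y. ennreal (g (v \<bullet> y)) * indicator K y \<partial>lborel)"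
      by (rule nn_integral_slices[OF v]) auto
    also have "\<dots> = (\<integral>\<^sup>+y. ennreal (g (v \<bullet> y) * indicator K y) \<partial>lborel)"
      by (intro nn_integral_cong) (auto simp: indicator_def)
    also have "\<dots> = ennreal (\<integral>y. g (v \<bullet> y) * indicator K y \<partial>lborel)"
      using that by (intro nn_integral_eq_integral) auto
    finally show "(\<integral>\<^sup>+t. ennreal (g t * slice_vol v K t) \<partial>lborel) = \<dots>" .
  qed (use g in \<open>auto simp: slice_vol_nonneg\<close>)
  let ?p = "\<lambda>t. max 0 (f t)" and ?m = "\<lambda>t. max 0 (- f t)"
  have ip: "integrable lborel (\<lambda>y. ?p (v \<bullet> y) * indicator K y)"
    by (rule Bochner_Integration.integrable_bound[OF int]) (auto simp: indicator_def)
  have im: "integrable lborel (\<lambda>y. ?m (v \<bullet> y) * indicator K y)"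
    by (rule Bochner_Integration.integrable_bound[OF int]) (auto simp: indicator_def)
  have split: "f t = ?p t - ?m t" for t
    by auto
  have "has_bochner_integral lborel (\<lambda>t. ?p t * slice_vol v K t - ?m t * slice_vol v K t)
     ((\<integral>y. ?p (v \<bullet> y) * indicator K y \<partial>lborel) - (\<integral>y. ?m (v \<bullet> y) * indicator K y \<partial>lborel))"
    by (intro has_bochner_integral_diff nonneg ip im) auto
  also have "(\<lambda>t. ?p t * slice_vol v K t - ?m t * slice_vol v K t) = (\<lambda>t. f t * slice_vol v K t)"
    by (simp add: left_diff_distrib[symmetric] split[symmetric])
  also have "(\<integral>y. ?p (v \<bullet> y) * indicator K y \<partial>lborel) - (\<integral>y. ?m (v \<bullet> y) * indicator K y \<partial>lborel) =
      (\<integral>y. f (v \<bullet> y) * indicator K y \<partial>lborel)"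
    using ip im by (subst Bochner_Integration.integral_diff[symmetric])
      (simp_all add: left_diff_distrib[symmetric] split[symmetric])
  finally show ?thesis .
qed

text \<open>The cylinder is sliced once more: its slices are constant for heights in
  \<open>{0..l}\<close> and empty elsewhere, so the Fubini formula integrates a constant.\<close>

lemma measure_slice_cylinder:
  fixes v :: "'a::euclidean_space"
  assumes v: "norm v = 1" and K: "compact K" and l: "l \<ge> 0"
  shows "measure lebesgue (slice_cylinder v K t l) = l * slice_vol v K t"
proof -
  have vv: "v \<bullet> v = 1"
    using v by (simp add: norm_eq_1)
  let ?C = "slice_cylinder v K t l"
  have C: "compact ?C"
    by (rule compact_slice_cylinder[OF v K])
  have slice: "slice_cylinder v ?C u 1 = (if u \<in> {0..l} then slice_cylinder v K t 1 else {})" for u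
    by (auto simp: slice_cylinder_def inner_add_right vv add.assoc scaleR_add_left[symmetric])
  have "emeasure lborel ?C = (\<integral>\<^sup>+y. 1 * indicator ?C y \<partial>lborel)"
    using borel_compact[OF C] by simp
  also have "\<dots> = (\<integral>\<^sup>+u. 1 * emeasure lborel (slice_cylinder v ?C u 1) \<partial>lborel)"
    using borel_compact[OF C] by (intro nn_integral_slices[OF v, symmetric]) auto
  also have "\<dots> = (\<integral>\<^sup>+u. ennreal (slice_vol v K t) * indicator {0..l} u \<partial>lborel)"
    by (intro nn_integral_cong) (auto simp: slice indicator_def emeasure_slice_cylinder[OF v K])
  also have "\<dots> = ennreal (l * slice_vol v K t)"
    using l by (simp add: nn_integral_cmult ennreal_mult' mult.commute slice_vol_nonneg)
  finally have "measure lborel ?C = l * slice_vol v K t"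
    using l slice_vol_nonneg[of v K t] by (simp add: measure_def)
  then show ?thesis
    using borel_compact[OF C] by simp
qed

text \<open>Taking as cylinder lengths the \<open>n\<close>-th roots of the slice volumes turns the \<open>(n + 1)\<close>-dimensional
  Brunn--Minkowski inequality into the sharp \<open>n\<close>-dimensional one for slices.\<close>

theorem Brunn_slices:
  fixes v :: "'a::euclidean_space"
  assumes v: "norm v = 1" and K: "compact K" "convex K" and d: "DIM('a) = Suc n" "n > 0"
    and x: "x \<in> K" and y: "y \<in> K" and \<theta>: "0 \<le> \<theta>" "\<theta> \<le> 1"
  shows "(1 - \<theta>) * root n (slice_vol v K (v \<bullet> x)) + \<theta> * root n (slice_vol v K (v \<bullet> y)) \<le>
    root n (slice_vol v K ((1 - \<theta>) * (v \<bullet> x) + \<theta> * (v \<bullet> y)))"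
proof -
  have vv: "v \<bullet> v = 1"
    using v by (simp add: norm_eq_1)
  define l where "l t = root n (slice_vol v K t)" for t
  have l: "l t \<ge> 0" "l t ^ n = slice_vol v K t" for t
    using d by (auto simp: l_def slice_vol_nonneg)
  define a b c where "a = v \<bullet> x" and "b = v \<bullet> y" and "c = (1 - \<theta>) * a + \<theta> * b"
  define m where "m = (1 - \<theta>) * l a + \<theta> * l b"
  have m: "m \<ge> 0"
    using \<theta> l by (simp add: m_def)
  let ?A = "(\<lambda>z. (1 - \<theta>) *\<^sub>R z + 0) ` slice_cylinder v K a (l a)"
  let ?B = "(\<lambda>z. \<theta> *\<^sub>R z + 0) ` slice_cylinder v K b (l b)"
  have ne: "z - (v \<bullet> z) *\<^sub>R v \<in> slice_cylinder v K (v \<bullet> z) (l (v \<bullet> z))" if "z \<in> K" for z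
    using that l by (simp add: slice_cylinder_def inner_diff_right vv)
  \<comment> \<open>A cylinder of length \<open>l t\<close> over a slice of volume
    \<open>l t ^ n\<close> has volume \<open>l t ^ Suc n\<close>. Scaling by \<open>\<eta>\<close>
    keeps this an exact \<open>DIM('a)\<close>-th power, as the Brunn-Minkowski inequality
    expects.\<close>
  have vol: "measure lebesgue ((\<lambda>z. \<eta> *\<^sub>R z + 0) ` slice_cylinder v K t (l t)) = (\<eta> * l t) ^ DIM('a)"
    if "\<eta> \<ge> 0" for \<eta> t
    using that unfolding measure_lebesgue_affine measure_slice_cylinder[OF v K(1) l(1)] l(2)[symmetric]
    by (simp add: power_mult_distrib d)
  have conv: "convex ((\<lambda>z. \<eta> *\<^sub>R z + 0) ` slice_cylinder v K t r)" for \<eta> t r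
    using convex_scaling[OF convex_slice_cylinder[OF K(2)]] by simp
  have comp: "compact ((\<lambda>z. \<eta> *\<^sub>R z + 0) ` slice_cylinder v K t r)" for \<eta> t r
    using compact_scaling[OF compact_slice_cylinder[OF v K(1)]] by simp
  have "m ^ DIM('a) \<le> measure lebesgue (?A + ?B)"
    unfolding m_def
  proof (rule Brunn_Minkowski_convex[OF comp conv _ vol comp conv _ vol])
    show "?A \<noteq> {}" "?B \<noteq> {}"
      using ne[OF x] ne[OF y] by (auto simp: a_def b_def)
  qed (use \<theta> l in auto)
  also have "\<dots> \<le> measure lebesgue (slice_cylinder v K c m)"
  proof (rule measure_mono_fmeasurable)
    show "?A + ?B \<subseteq> slice_cylinder v K c m"
    proof (rule subsetI, elim set_plus_elim imageE, simp)
      fix p q assume p: "p \<in> slice_cylinder v K a (l a)" and q: "q \<in> slice_cylinder v K b (l b)"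
      have "(1 - \<theta>) *\<^sub>R (p + (a - v \<bullet> p) *\<^sub>R v) + \<theta> *\<^sub>R (q + (b - v \<bullet> q) *\<^sub>R v) \<in> K"
        using p q \<theta> by (intro convexD[OF K(2)]) (auto simp: slice_cylinder_def)
      also have "(1 - \<theta>) *\<^sub>R (p + (a - v \<bullet> p) *\<^sub>R v) + \<theta> *\<^sub>R (q + (b - v \<bullet> q) *\<^sub>R v) =
        ((1 - \<theta>) *\<^sub>R p + \<theta> *\<^sub>R q) + (c - v \<bullet> ((1 - \<theta>) *\<^sub>R p + \<theta> *\<^sub>R q)) *\<^sub>R v"
        by (simp add: c_def algebra_simps inner_add_right inner_diff_right)
      finally show "(1 - \<theta>) *\<^sub>R p + \<theta> *\<^sub>R q \<in> slice_cylinder v K c m"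
        using p q \<theta> unfolding slice_cylinder_def m_def
        by (auto simp: inner_add_right intro!: add_mono mult_left_mono add_nonneg_nonneg)
    qed
    show "?A + ?B \<in> sets lebesgue"
      by (intro fmeasurableD lmeasurable_compact compact_set_plus comp)
    show "slice_cylinder v K c m \<in> lmeasurable"
      by (intro lmeasurable_compact compact_slice_cylinder v K)
  qed
  also have "\<dots> = m * slice_vol v K c"
    by (rule measure_slice_cylinder[OF v K(1) m])
  finally have "m * m ^ n \<le> m * l c ^ n"
    by (simp add: d l)
  then have "m \<le> l c"
    using m l(1)[of c] d(2) by (cases "m = 0") (auto intro: power_le_imp_le_base)
  then show ?thesis
    by (simp add: m_def l_def a_def b_def c_def)
qed

section \<open>Comparison with a cone\<close>

text \<open>Used with exponent \<open>n\<close> for the mass of a cone, in total and above height 0,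
  and with exponent \<open>n + 1\<close> for its first moment.\<close>

lemma has_bochner_integral_cone:
  fixes a \<tau> c :: real
  assumes "\<tau> > 0" "a \<le> \<tau>"
  shows "has_bochner_integral lborel (\<lambda>t. c * (1 - t / \<tau>) ^ k * indicator {a..\<tau>} t)
    (c * \<tau> / (real k + 1) * (1 - a / \<tau>) ^ (k + 1))"
proof -
  let ?F = "\<lambda>t. - (c * \<tau> / (real k + 1)) * (1 - t / \<tau>) ^ (k + 1)"
  have "has_bochner_integral lborel (\<lambda>t. c * (1 - t / \<tau>) ^ k * indicator {a..\<tau>} t) (?F \<tau> - ?F a)"
  proof (rule has_bochner_integral_FTC_Icc_real)
    show "(?F has_real_derivative c * (1 - t / \<tau>) ^ k) (at t)" for t
    proof -
      have "((\<lambda>t. 1 - t / \<tau>) has_real_derivative - (1 / \<tau>)) (at t)"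
        using assms by (auto intro!: derivative_eq_intros)
      note DERIV_cmult[OF DERIV_power_Suc[OF this, of k], of "- (c * \<tau> / (real k + 1))"]
      moreover have "- (c * \<tau> / (real k + 1)) * ((1 + real k) * (- (1 / \<tau>) * (1 - t / \<tau>) ^ k)) =
          c * (1 - t / \<tau>) ^ k"
      proof -
        have "real k + 1 \<noteq> 0"
          by linarith
        then show ?thesis
          using assms by (simp add: divide_simps)
      qed
      ultimately show ?thesis
        by simp
    qed
  qed (use assms in \<open>auto intro!: continuous_intros\<close>)
  then show ?thesis
    using assms by simp
qed

text \<open>The right-hand side is the first moment of the cone with apex \<open>\<tau>\<close> that agrees with \<open>h\<close> at 0 and
  has the same mass on \<open>{0..}\<close> and in total; its height is \<open>\<tau> / x\<close>.\<close>

lemma cone_moment_comparison: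
  fixes h :: "real \<Rightarrow> real" and n :: nat and P M V Vp x \<tau> :: real
  assumes n: "n > 0" and P: "P > 0" "M \<ge> 0"
    and h: "\<And>t. h t \<ge> 0" "\<And>t. t \<notin> {-M..P} \<Longrightarrow> h t = 0" "h 0 > 0"
    and conc: "\<And>a b \<theta>. a \<in> {-M..P} \<Longrightarrow> b \<in> {-M..P} \<Longrightarrow> 0 \<le> \<theta> \<Longrightarrow> \<theta> \<le> 1 \<Longrightarrow>
      (1 - \<theta>) * root n (h a) + \<theta> * root n (h b) \<le> root n (h ((1 - \<theta>) * a + \<theta> * b))"
    and int: "integrable lborel h" "integrable lborel (\<lambda>t. t * h t)"
    and Vp: "Vp = (\<integral>t. h t * indicator {0..} t \<partial>lborel)" "Vp > 0"
    and V: "V = (\<integral>t. h t \<partial>lborel)"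
    and x: "x > 0" "x ^ (n + 1) * V = Vp"
    and \<tau>: "\<tau> = (n + 1) * Vp / h 0"
  shows "(\<integral>t. t * h t \<partial>lborel) \<le> V * (\<tau> - \<tau> / x * ((n + 1) / (n + 2)))"
proof -
  have inth: "integrable lborel (\<lambda>t. h t * indicator {0..} t)"
    using int(1) by (rule integrable_real_mult_indicator[rotated]) simp
  have "Vp \<le> V"
    unfolding Vp V using h by (intro integral_mono inth int) (auto simp: indicator_def)
  then have "V > 0"
    using Vp by simp
  have "x \<le> 1"
  proof (rule ccontr)
    assume "\<not> x \<le> 1"
    then have "x ^ (n + 1) > 1"
      by (intro one_less_power) auto
    then have "x ^ (n + 1) * V > 1 * V"
      using \<open>V > 0\<close> by (intro mult_strict_right_mono)
    with x \<open>Vp \<le> V\<close> show False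
      by simp
  qed
  have \<tau>0: "\<tau> > 0"
    using Vp h by (simp add: \<tau>)
  have h0: "h 0 * \<tau> / (n + 1) = Vp"
    using h(3) by (simp add: \<tau>)
  \<comment> \<open>The base of the comparison cone lies at height \<open>-b\<close>, that is
    \<open>\<tau> / x\<close> below the apex. It is not above 0 because
    \<open>x \<le> 1\<close>.\<close>
  define b where "b = \<tau> / x - \<tau>"
  have b: "b \<ge> 0"
    using \<open>x \<le> 1\<close> x \<tau>0 by (simp add: b_def field_simps)
  have bx: "1 - (-b) / \<tau> = 1 / x"
    using \<tau>0 x by (simp add: b_def field_simps)
  define \<phi> where "\<phi> t = h 0 * (1 - t / \<tau>) ^ n * indicator {-b..\<tau>} t" for t
  have \<phi>1: "has_bochner_integral lborel \<phi> V"
  proof -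
    have "h 0 * \<tau> / (n + 1) * (1 - (-b) / \<tau>) ^ (n + 1) = V"
      using x \<tau>0 unfolding h0 bx by (simp add: power_divide field_simps)
    then show ?thesis
      using has_bochner_integral_cone[OF \<tau>0, of "-b" "h 0" n] b \<tau>0 unfolding \<phi>_def by (simp add: add.commute)
  qed
  have \<phi>p: "has_bochner_integral lborel (\<lambda>t. \<phi> t * indicator {0..} t) Vp"
  proof -
    have "(\<lambda>t. \<phi> t * indicator {0..} t) = (\<lambda>t. h 0 * (1 - t / \<tau>) ^ n * indicator {0..\<tau>} t)"
      using b by (auto simp: \<phi>_def indicator_def)
    then show ?thesis
      using has_bochner_integral_cone[OF \<tau>0, of 0 "h 0" n] \<tau>0 h0 by (simp add: add.commute)
  qed
  have \<phi>t: "has_bochner_integral lborel (\<lambda>t. t * \<phi> t) (V * (\<tau> - \<tau> / x * ((n + 1) / (n + 2))))"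
  proof -
    \<comment> \<open>The identity \<open>t = \<tau> - \<tau> * (1 - t / \<tau>)\<close> reduces the
      first moment to the mass and to a cone integral with the next exponent.\<close>
    have "has_bochner_integral lborel (\<lambda>t. \<tau> * \<phi> t - \<tau> * h 0 * (1 - t / \<tau>) ^ (n + 1) * indicator {-b..\<tau>} t)
        (\<tau> * V - \<tau> * h 0 * \<tau> / (real (n + 1) + 1) * (1 - (-b) / \<tau>) ^ (n + 1 + 1))"
      using b \<tau>0 by (intro has_bochner_integral_diff has_bochner_integral_mult_right \<phi>1
          has_bochner_integral_cone) linarith+
    also have "(\<lambda>t. \<tau> * \<phi> t - \<tau> * h 0 * (1 - t / \<tau>) ^ (n + 1) * indicator {-b..\<tau>} t) = (\<lambda>t. t * \<phi> t)"
      using \<tau>0 by (auto simp: \<phi>_def indicator_def fun_eq_iff field_simps)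
    also have "\<tau> * V - \<tau> * h 0 * \<tau> / (real (n + 1) + 1) * (1 - (-b) / \<tau>) ^ (n + 1 + 1) =
        V * (\<tau> - \<tau> / x * ((n + 1) / (n + 2)))"
    proof -
      have "h 0 * \<tau> = (n + 1) * (x ^ (n + 1) * V)"
        using h0 x(2) by (simp add: field_simps)
      then have "\<tau> * h 0 * \<tau> / (real (n + 1) + 1) * (1 - (-b) / \<tau>) ^ (n + 1 + 1) =
          \<tau> * ((n + 1) * (x ^ (n + 1) * V)) / (n + 2) * (1 / x) ^ (n + 1 + 1)"
        unfolding bx by (simp add: mult.assoc add.commute)
      also have "\<dots> = V * (\<tau> / x * ((n + 1) / (n + 2)))"
        using x(1) by (simp add: power_divide mult_ac)
      finally show ?thesis
        by (simp add: algebra_simps)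
    qed
    finally show ?thesis .
  qed

  define g where "g t = root n (h t)" for t
  have g: "g t \<ge> 0" "g t ^ n = h t" for t
    using n h by (auto simp: g_def)
  have g0: "g 0 > 0"
    using n h by (simp add: g_def)
  \<comment> \<open>On the support of \<open>\<phi>\<close> this affine function is the
    \<open>n\<close>-th root of \<open>\<phi>\<close>, and it agrees with \<open>g\<close> at 0.
    Comparing \<open>h\<close> with \<open>\<phi>\<close> becomes comparing a concave function with
    a line.\<close>
  define L where "L t = g 0 * (1 - t / \<tau>)" for t
  have Ln: "L t ^ n = h 0 * (1 - t / \<tau>) ^ n" for t
    by (simp add: L_def power_mult_distrib g)
  have L_nonneg: "L t \<ge> 0 \<longleftrightarrow> t \<le> \<tau>" for t
    using g0 \<tau>0 by (simp add: L_def zero_le_mult_iff field_simps)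
  \<comment> \<open>The supremum \<open>s\<close> of this set separates two regimes: concavity gives
    \<open>L \<le> g\<close> on the open interval from 0 to \<open>s\<close>, and maximality gives
    \<open>g < L\<close> from there up to \<open>P\<close>.\<close>
  define S where "S = {t \<in> {0..P}. L t \<le> g t}"
  have S0: "0 \<in> S"
    using P by (simp add: S_def L_def)
  have bdd: "bdd_above S"
    by (rule bdd_aboveI[of _ P]) (auto simp: S_def)
  define s where "s = Sup S"
  have s: "0 \<le> s" "s \<le> P"
    unfolding s_def using S0 bdd by (auto intro!: cSup_upper cSup_least simp: S_def)
  have below: "L t \<le> g t" if "t' \<in> S" "0 < t" "t < t'" for t t'
  proof -
    have "(1 - t / t') * g 0 + t / t' * g t' \<le> g ((1 - t / t') * 0 + t / t' * t')"
      unfolding g_def using that P by (intro conc) (auto simp: S_def)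
    then have "(1 - t / t') * g 0 + t / t' * L t' \<le> g t"
      using that by (smt (verit) S_def divide_nonneg_nonneg mem_Collect_eq mult_left_mono mult_zero_right
          nonzero_eq_divide_eq)
    moreover have "(1 - t / t') * g 0 + t / t' * L t' = L t"
      using that \<tau>0 by (simp add: L_def field_simps)
    ultimately show ?thesis
      by simp
  qed
  have above: "g t < L t" if "s < t" "t \<le> P" for t
  proof (rule ccontr)
    assume "\<not> g t < L t"
    then have "t \<in> S"
      using that s by (auto simp: S_def)
    then show False
      using cSup_upper[OF _ bdd, of t] that by (simp add: s_def)
  qed
  have h_le: "h t \<le> \<phi> t" if "g t \<le> L t" "-b \<le> t" for t
  proof -
    have "t \<le> \<tau>"
      using that g(1)[of t] L_nonneg[of t] by linarith
    then show ?thesis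
      using that power_mono[OF that(1) g(1), of n] by (simp add: \<phi>_def g Ln)
  qed
  have \<phi>_le: "\<phi> t \<le> h t" if "L t \<le> g t" for t
    using power_mono[OF that, of n] L_nonneg[of t] h(1)[of t] by (auto simp: \<phi>_def indicator_def g Ln)
  have \<phi>_nonneg: "\<phi> t \<ge> 0" for t
    using \<tau>0 h(3) by (auto simp: \<phi>_def indicator_def field_simps)

  \<comment> \<open>Otherwise \<open>h < \<phi>\<close> on all of \<open>{0<..P}\<close>, although
    both functions have mass \<open>Vp\<close> on \<open>{0..}\<close>.\<close>
  have "\<exists>t1\<in>S. t1 > 0"
  proof (rule ccontr)
    assume "\<not> (\<exists>t1\<in>S. t1 > 0)"
    then have lt: "g t < L t" if "0 < t" "t \<le> P" for t
      using that by (force simp: S_def)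
    have strict: "h t < \<phi> t" if "0 < t" "t \<le> P" for t
    proof -
      have "t \<le> \<tau>"
        using lt[OF that] g(1)[of t] L_nonneg[of t] by linarith
      then show ?thesis
        using that b power_strict_mono[OF lt[OF that] g(1) n] by (simp add: \<phi>_def g Ln)
    qed
    let ?D = "\<lambda>t. \<phi> t * indicator {0..} t - h t * indicator {0..} t"
    have "has_bochner_integral lborel ?D (Vp - Vp)"
      using \<phi>p inth Vp(1) by (intro has_bochner_integral_diff) (auto simp: has_bochner_integral_iff)
    moreover have "?D t \<ge> 0" for t
    proof -
      consider "t < 0" | "t = 0" | "0 < t" "t \<le> P" | "t > P"
        by linarith
      then show ?thesis
        using strict[of t] \<phi>_nonneg[of t] h(2)[of t] b \<tau>0 by cases (auto simp: \<phi>_def)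
    qed
    ultimately have "AE t in lborel. ?D t = 0"
      using integral_nonneg_eq_0_iff_AE[of lborel ?D] by (auto simp: has_bochner_integral_iff)
    then have "AE t in lborel. t \<notin> {0<..P}"
      by (rule AE_mp) (use strict in \<open>force intro!: AE_I2\<close>)
    then have "emeasure lborel {0<..P} = 0"
      by (subst (asm) AE_iff_measurable[of "{0<..P}"]) auto
    then show False
      using P by simp
  qed
  then obtain t1 where t1: "t1 \<in> S" "t1 > 0"
    by blast
  have left: "g t \<le> L t" if "-M \<le> t" "t < 0" for t
  proof -
    \<comment> \<open>The weight that writes 0 as a convex combination of \<open>t\<close> and
      \<open>t1\<close>. As \<open>g\<close> is at least \<open>L\<close> at \<open>t1\<close> and
      equal to \<open>L\<close> at 0, concavity forbids \<open>g\<close> from exceeding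
      \<open>L\<close> at \<open>t\<close>.\<close>
    let ?\<theta> = "- t / (t1 - t)"
    have \<theta>: "0 \<le> ?\<theta>" "?\<theta> \<le> 1" "1 - ?\<theta> = t1 / (t1 - t)" "(1 - ?\<theta>) * t + ?\<theta> * t1 = 0"
      using that t1 by (auto simp: field_simps)
    have "(1 - ?\<theta>) * g t + ?\<theta> * g t1 \<le> g ((1 - ?\<theta>) * t + ?\<theta> * t1)"
      unfolding g_def using that t1 P \<theta>(1,2) by (intro conc) (auto simp: S_def)
    moreover have "?\<theta> * L t1 \<le> ?\<theta> * g t1"
      using t1 \<theta>(1) by (intro mult_left_mono) (auto simp: S_def)
    ultimately have "(1 - ?\<theta>) * g t + ?\<theta> * L t1 \<le> g 0"
      unfolding \<theta>(4) by linarith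
    then have "((1 - ?\<theta>) * g t + ?\<theta> * L t1) * (t1 - t) \<le> g 0 * (t1 - t)"
      using that t1 by (intro mult_right_mono) auto
    also have "((1 - ?\<theta>) * g t + ?\<theta> * L t1) * (t1 - t) = t1 * g t + (- t) * L t1"
      unfolding \<theta>(3) using that t1 by (simp add: diff_divide_distrib[symmetric])
    finally have "t1 * g t + (- t) * L t1 \<le> g 0 * (t1 - t)" .
    also have "g 0 * (t1 - t) = t1 * L t + (- t) * L t1"
      using \<tau>0 by (simp add: L_def field_simps)
    finally show ?thesis
      using t1 by simp
  qed

  \<comment> \<open>\<open>h - \<phi>\<close> changes sign exactly at \<open>-b\<close>, \<open>0\<close> and \<open>s\<close>; \<open>w\<close> differs from the identity by a
    function against which \<open>h - \<phi>\<close> integrates to 0.\<close>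
  define w where "w t = t + b - (b + s) * indicator {0..} t" for t :: real
  have "w t * (h t - \<phi> t) \<le> 0" for t
  proof -
    consider "t < -b" | "-b \<le> t" "t < 0" | "t = 0" | "0 < t" "t < s" | "0 < t" "t = s" | "0 < t" "s < t"
      by linarith
    then show ?thesis
    proof cases
      case 1
      then show ?thesis
        using b h(1)[of t] by (auto simp: w_def \<phi>_def mult_le_0_iff)
    next
      case 2
      have "h t \<le> \<phi> t"
        using 2 left[of t] h_le[of t] h(2)[of t] \<phi>_nonneg[of t] by (cases "-M \<le> t") auto
      then show ?thesis
        using 2 by (auto simp: w_def mult_le_0_iff)
    next
      case 3
      then show ?thesis
        using b \<tau>0 by (simp add: \<phi>_def)
    next
      case 4
      obtain t' where "t' \<in> S" "t < t'"
        using 4 S0 less_cSup_iff[OF _ bdd, of t] by (auto simp: s_def)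
      then have "\<phi> t \<le> h t"
        using below[of t' t] 4 by (intro \<phi>_le) auto
      then show ?thesis
        using 4 by (auto simp: w_def mult_le_0_iff)
    next
      case 5
      then show ?thesis
        by (simp add: w_def)
    next
      case 6
      have "h t \<le> \<phi> t"
        using 6 above[of t] h_le[of t] h(2)[of t] \<phi>_nonneg[of t] b by (cases "t \<le> P") auto
      then show ?thesis
        using 6 by (auto simp: w_def mult_le_0_iff)
    qed
  qed
  then have "0 \<le> (\<integral>t. - (w t * (h t - \<phi> t)) \<partial>lborel)"
    by (intro Bochner_Integration.integral_nonneg) simp
  then have "(\<integral>t. w t * (h t - \<phi> t) \<partial>lborel) \<le> 0"
    by simp
  \<comment> \<open>Expanding \<open>w t * (h t - \<phi> t)\<close>: equal masses, in total and on
    \<open>{0..}\<close>, cancel the last two terms and leave the difference of the first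
    moments.\<close>
  moreover have "has_bochner_integral lborel (\<lambda>t. (t * h t - t * \<phi> t) + b * (h t - \<phi> t) -
      (b + s) * (h t * indicator {0..} t - \<phi> t * indicator {0..} t))
     (((\<integral>t. t * h t \<partial>lborel) - V * (\<tau> - \<tau> / x * ((n + 1) / (n + 2)))) + b * (V - V) - (b + s) * (Vp - Vp))"
    using int inth V Vp(1)
    by (intro has_bochner_integral_diff has_bochner_integral_add has_bochner_integral_mult_right \<phi>1 \<phi>p \<phi>t)
       (auto simp: has_bochner_integral_iff)
  moreover have "(\<lambda>t. (t * h t - t * \<phi> t) + b * (h t - \<phi> t) -
      (b + s) * (h t * indicator {0..} t - \<phi> t * indicator {0..} t)) = (\<lambda>t. w t * (h t - \<phi> t))"
    by (auto simp: w_def algebra_simps)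
  ultimately show ?thesis
    by (simp add: has_bochner_integral_iff)
qed

section \<open>The volume of the upper part\<close>

lemma exp_minus_one_le_power:
  fixes d :: nat
  assumes "d > 0"
  shows "exp (-1) \<le> (d / (d + 1)) ^ d"
proof -
  have "(1 + 1 / d) ^ d \<le> exp (1 / d) ^ d"
    by (intro power_mono exp_ge_add_one_self) auto
  also have "\<dots> = exp 1"
    using assms by (simp add: exp_of_nat_mult[symmetric])
  finally have "inverse (exp 1) \<le> inverse ((1 + 1 / d) ^ d)"
    by (intro le_imp_inverse_le) (auto intro!: zero_less_power add_pos_nonneg)
  also have "inverse ((1 + 1 / d) ^ d) = (d / (d + 1)) ^ d"
  proof -
    have "inverse (1 + 1 / d) = d / (d + 1)"
      using assms by (simp add: field_simps)
    then show ?thesis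
      by (simp add: power_inverse[symmetric])
  qed
  finally show ?thesis
    by (simp add: exp_minus)
qed

text \<open>The homothety centred at \<open>p\<close> sends height \<open>-M\<close> to height 0,
  which determines its ratio. Convexity keeps the image inside \<open>K\<close>.\<close>

lemma measure_halfspace_ge_homothety:
  fixes K :: "'a::euclidean_space set"
  assumes K: "compact K" "convex K" and p: "p \<in> K" "v \<bullet> p = P" "P \<ge> 0"
    and M: "M > 0" "\<And>z. z \<in> K \<Longrightarrow> - M \<le> v \<bullet> z"
  shows "(P / (P + M)) ^ DIM('a) * measure lebesgue K \<le> measure lebesgue (K \<inter> {w. v \<bullet> w \<ge> 0})"
proof -
  define r where "r = P / (P + M)"
  have r: "0 \<le> r" "r \<le> 1" "(1 - r) * P = r * M"
    using p M by (auto simp: r_def field_simps)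
  let ?T = "\<lambda>z. r *\<^sub>R z + (1 - r) *\<^sub>R p"
  have "r ^ DIM('a) * measure lebesgue K = measure lebesgue (?T ` K)"
    using r by (simp add: measure_lebesgue_affine del: measure_completion)
  also have "\<dots> \<le> measure lebesgue (K \<inter> {w. v \<bullet> w \<ge> 0})"
  proof (rule measure_mono_fmeasurable)
    show "?T ` K \<subseteq> K \<inter> {w. v \<bullet> w \<ge> 0}"
    proof safe
      fix z assume z: "z \<in> K"
      show "?T z \<in> K"
        using z p r by (intro convexD[OF K(2)]) auto
      have "r * (- M) \<le> r * (v \<bullet> z)"
        using r M(2)[OF z] by (intro mult_left_mono)
      then show "0 \<le> v \<bullet> ?T z"
        using r by (simp add: inner_add_right p)
    qed
    show "?T ` K \<in> sets lebesgue"
      by (intro fmeasurableD lmeasurable_compact compact_continuous_image continuous_intros K)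
    show "K \<inter> {w. 0 \<le> v \<bullet> w} \<in> lmeasurable"
      by (intro lmeasurable_compact compact_Int_closed K closed_halfspace_ge)
  qed
  finally show ?thesis
    by (simp add: r_def)
qed

lemma hyp_vol_eq_slice_vol:
  assumes v: "norm v = 1"
  shows "hyp_vol v (K \<inter> {w. v \<bullet> w = 0}) = slice_vol v K 0"
proof -
  have vv: "v \<bullet> v = 1"
    using v by (simp add: norm_eq_1)
  have "{w + t *\<^sub>R v |w t. w \<in> K \<inter> {w. v \<bullet> w = 0} \<and> t \<in> {0..1}} = slice_cylinder v K 0 1"
  proof safe
    fix w and t :: real assume "w \<in> K" "v \<bullet> w = 0" "t \<in> {0..1}"
    then show "w + t *\<^sub>R v \<in> slice_cylinder v K 0 1"
      by (simp add: slice_cylinder_def inner_add_right vv)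
  next
    fix x assume x: "x \<in> slice_cylinder v K 0 1"
    then show "\<exists>w t. x = w + t *\<^sub>R v \<and> w \<in> K \<inter> {w. v \<bullet> w = 0} \<and> t \<in> {0..1}"
      by (intro exI[of _ "x - (v \<bullet> x) *\<^sub>R v"] exI[of _ "v \<bullet> x"])
        (auto simp: slice_cylinder_def inner_diff_right vv)
  qed
  then show ?thesis
    by (simp add: hyp_vol_def slice_vol_def)
qed

text \<open>Connects the gauge integral in \<open>cg\<close> with the Lebesgue integral to which the
  slice formula applies.\<close>

lemma inner_cg:
  fixes K :: "'a::euclidean_space set"
  assumes K: "compact K"
  shows "v \<bullet> cg K = (\<integral>y. (v \<bullet> y) * indicator K y \<partial>lborel) / measure lebesgue K"
proof -
  have int: "integrable lborel (\<lambda>y. indicator K y *\<^sub>R y)"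
    by (intro borel_integrable_compact K continuous_intros)
  then have "set_integrable lborel K (\<lambda>y. y)"
    by (simp add: set_integrable_def)
  then have "integral K (\<lambda>y. y) = (\<integral>y. indicator K y *\<^sub>R y \<partial>lborel)"
    using set_borel_integral_eq_integral(2)[of K "\<lambda>y. y"] by (simp add: set_lebesgue_integral_def)
  then have "v \<bullet> integral K (\<lambda>y. y) = (\<integral>y. v \<bullet> (indicator K y *\<^sub>R y) \<partial>lborel)"
    using int by (simp only: integral_inner_right)
  then show ?thesis
    by (simp add: cg_def mult.commute)
qed

text \<open>Since \<open>x ^ (n + 1) * V = Vp\<close>, replacing \<open>q\<close> by the larger
  \<open>x\<close> turns the shift into \<open>lam * (n + 1) / (n + 2)\<close> times the cone height
  \<open>\<tau> / x\<close>. Both sides then scale with \<open>\<tau>\<close>, which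
  cancels.\<close>

lemma cone_ratio_bound:
  fixes n :: nat and V Vp h0 x q \<tau> lam :: real
  assumes pos: "V > 0" "Vp > 0" "h0 > 0" "x > 0" and x: "x ^ (n + 1) * V = Vp" and q: "0 \<le> q" "q \<le> x"
    and lam: "0 \<le> lam" and \<tau>: "\<tau> = (n + 1) * Vp / h0"
    and bound: "- (lam * ((n + 1) * V / h0) * q ^ n * ((n + 1) / (n + 2))) \<le> \<tau> - \<tau> / x * ((n + 1) / (n + 2))"
  shows "(n + 1) / (n + 2) * (1 - lam) \<le> x"
proof -
  define c where "c = real (n + 1) / real (n + 2)"
  have c: "c \<ge> 0"
    by (simp add: c_def)
  have \<tau>x: "(n + 1) * V / h0 * x ^ n = \<tau> / x"
    using pos by (simp add: \<tau> x[symmetric])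
  have \<tau>0: "\<tau> > 0"
    using pos by (simp add: \<tau>)
  have "lam * ((n + 1) * V / h0) * q ^ n * c \<le> lam * ((n + 1) * V / h0) * x ^ n * c"
    using pos q lam c by (intro mult_right_mono mult_left_mono power_mono) auto
  also have "\<dots> = ((n + 1) * V / h0 * x ^ n) * (lam * c)"
    by simp
  also have "\<dots> = \<tau> / x * (lam * c)"
    unfolding \<tau>x ..
  finally have "\<tau> / x * c - \<tau> / x * (lam * c) \<le> \<tau>"
    using bound[folded c_def] by linarith
  then have "\<tau> / x * (c * (1 - lam)) \<le> \<tau>"
    by (simp add: algebra_simps)
  then have "\<tau> * (c * (1 - lam)) \<le> \<tau> * x"
    using pos by (simp add: field_simps)
  then show ?thesis
    using \<tau>0 unfolding c_def[symmetric] by simp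
qed

theorem theorem2:
  fixes K :: "'a::euclidean_space set" and v :: 'a and lam :: real
  defines "d \<equiv> DIM('a)"
  defines "W \<equiv> {w. v \<bullet> w = 0}"
  defines "Kp \<equiv> K \<inter> {w. v \<bullet> w \<ge> 0}"
  defines "Km \<equiv> K \<inter> {w. v \<bullet> w < 0}"
  defines "Hp \<equiv> Sup ((\<lambda>a. a \<bullet> v) ` Kp)"
  defines "Hm \<equiv> Sup ((\<lambda>a. - (a \<bullet> v)) ` Km)"
  defines "\<omega> \<equiv> unit_ball_vol (real d - 1)"
  defines "R \<equiv> (hyp_vol v (K \<inter> W) / \<omega>) powr (1 / (real d - 1))"
  defines "\<Lambda> \<equiv> lam * (real d * measure lebesgue K / (\<omega> * R ^ (d - 1)))
                  * (Hp / ((real d + 1) * Hm)) ^ (d - 1) * (1 - 1 / (real d + 1))"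
  assumes "d \<ge> 2"
    and "convex_body K"
    and "norm v = 1"
    and "Kp \<noteq> {}" and "Km \<noteq> {}"
    and "hyp_vol v (K \<inter> W) > 0"
    and "0 \<le> lam" and "lam \<le> 1"
    and "cg K + \<Lambda> *\<^sub>R v \<in> Kp"
  shows "measure lebesgue Kp / measure lebesgue K \<ge> exp (-1) * (1 - lam) ^ d"
proof -
  note v = \<open>norm v = 1\<close>
  have vv: "v \<bullet> v = 1"
    using v by (simp add: norm_eq_1)
  have K: "compact K" "convex K" "interior K \<noteq> {}"
    using \<open>convex_body K\<close> by (auto simp: convex_body_def)
  define n where "n = d - 1"
  have n: "n > 0" "d = Suc n" "DIM('a) = Suc n"
    using \<open>d \<ge> 2\<close> by (auto simp: n_def d_def)
  have lmK: "K \<in> lmeasurable"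
    using K(1) by (rule lmeasurable_compact)
  have Kp: "compact Kp"
    unfolding Kp_def by (intro compact_Int_closed K closed_halfspace_ge)
  define V Vp where "V = measure lebesgue K" and "Vp = measure lebesgue Kp"
  have V: "V > 0"
    using K lmK open_not_negligible[OF open_interior K(3)] negligible_subset[OF _ interior_subset]
    by (metis V_def less_eq_real_def measure_nonneg negligible_iff_measure0)

  have cont: "continuous_on S (\<lambda>z. v \<bullet> z)" for S
    by (intro continuous_intros)
  obtain p where p: "p \<in> Kp" "\<And>z. z \<in> Kp \<Longrightarrow> v \<bullet> z \<le> v \<bullet> p"
    using continuous_attains_sup[OF Kp \<open>Kp \<noteq> {}\<close> cont] by blast
  have Hp: "Hp = v \<bullet> p"
    unfolding Hp_def using p by (intro cSup_eq_maximum) (auto simp: inner_commute)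
  have p_max: "v \<bullet> z \<le> Hp" if "z \<in> K" for z
    using that p(1) p(2)[of z] by (cases "v \<bullet> z \<ge> 0") (auto simp: Hp Kp_def)
  have Hp0: "Hp \<ge> 0"
    using p by (simp add: Hp Kp_def)
  \<comment> \<open>\<open>Km\<close> need not be closed, so the lowest point is sought in the
    compact \<open>K\<close>. As \<open>Km\<close> is nonempty, this point belongs to
    \<open>Km\<close>.\<close>
  obtain m where m: "m \<in> K" "\<And>z. z \<in> K \<Longrightarrow> v \<bullet> m \<le> v \<bullet> z"
    using continuous_attains_inf[OF K(1) _ cont] K(3) interior_subset[of K] by blast
  have "v \<bullet> m < 0"
    using m(2) \<open>Km \<noteq> {}\<close> unfolding Km_def by fastforce
  have Hm: "Hm = - (v \<bullet> m)"
    unfolding Hm_def using m \<open>v \<bullet> m < 0\<close>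
    by (intro cSup_eq_maximum) (auto simp: inner_commute Km_def)
  have Hm0: "Hm > 0"
    using \<open>v \<bullet> m < 0\<close> by (simp add: Hm)

  define h where "h = slice_vol v K"
  have h0: "h 0 = hyp_vol v (K \<inter> W)" "h 0 > 0"
    using \<open>hyp_vol v (K \<inter> W) > 0\<close> by (auto simp: h_def W_def hyp_vol_eq_slice_vol[OF v])
  have \<omega>: "\<omega> > 0"
    unfolding \<omega>_def using \<open>d \<ge> 2\<close> by (intro unit_ball_vol_pos) auto
  \<comment> \<open>By the choice of \<open>R\<close>, the denominator in \<open>\<Lambda>\<close>
    is the volume of the central slice.\<close>
  have R: "\<omega> * R ^ (d - 1) = h 0"
  proof -
    have "R > 0"
      using h0 \<omega> by (simp add: R_def)
    then have "R ^ n = R powr real n"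
      by (simp add: powr_realpow)
    also have "\<dots> = h 0 / \<omega>"
      using h0 \<omega> n by (simp add: R_def powr_powr)
    finally show ?thesis
      using \<omega> by (simp add: n_def)
  qed
  define q where "q = Hp / ((real d + 1) * Hm)"
  have \<Lambda>: "\<Lambda> = lam * ((n + 1) * V / h 0) * q ^ n * ((n + 1) / (n + 2))"
  proof -
    have "1 - 1 / (real d + 1) = (n + 1) / (n + 2)"
      by (simp add: n(2) field_simps)
    then show ?thesis
      unfolding \<Lambda>_def R q_def V_def by (simp add: n(2))
  qed
  have "v \<bullet> (cg K + \<Lambda> *\<^sub>R v) \<ge> 0"
    using \<open>cg K + \<Lambda> *\<^sub>R v \<in> Kp\<close> unfolding Kp_def by blast
  then have cg: "v \<bullet> cg K \<ge> - \<Lambda>"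
    by (simp add: inner_add_right vv)
  have int: "integrable lborel (\<lambda>y. f y * indicator K y)" if "continuous_on UNIV f" for f :: "'a \<Rightarrow> real"
    using borel_integrable_compact[OF K(1) continuous_on_subset[OF that subset_UNIV]]
    by (simp add: mult.commute)
  define I where "I = (\<integral>y. (v \<bullet> y) * indicator K y \<partial>lborel)"
  have I: "v \<bullet> cg K = I / V"
    by (simp add: I_def V_def inner_cg[OF K(1)])

  \<comment> \<open>If \<open>Hp = 0\<close>, the shift vanishes and the centre of gravity has
    nonnegative height, while no point of \<open>K\<close> has positive height. Then almost all of
    \<open>K\<close> lies in the hyperplane, contradicting \<open>V > 0\<close>.\<close>
  have "Hp > 0"
  proof (rule ccontr)
    assume "\<not> Hp > 0"
    then have "Hp = 0"
      using Hp0 by simp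
    then have "\<Lambda> = 0"
      using n by (simp add: \<Lambda> q_def)
    then have "I \<ge> 0"
      using cg I V by (simp add: zero_le_divide_iff)
    let ?f = "\<lambda>y. - (v \<bullet> y) * indicator K y"
    have intf: "integrable lborel ?f"
      by (intro int continuous_intros)
    have nonneg: "?f y \<ge> 0" for y
      using p_max[of y] \<open>Hp = 0\<close> by (auto simp: indicator_def)
    have "(\<integral>y. ?f y \<partial>lborel) = 0"
      using \<open>I \<ge> 0\<close> Bochner_Integration.integral_nonneg[of lborel ?f] nonneg by (simp add: I_def)
    then have "AE y in lborel. ?f y = 0"
      using integral_nonneg_eq_0_iff_AE[OF intf] nonneg by simp
    then have "AE y in lebesgue. ?f y = 0"
      by (rule AE_completion)
    moreover have "negligible {y. v \<bullet> y = 0}"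
      using v by (intro negligible_hyperplane) auto
    then have "AE y in lebesgue. y \<notin> {y. v \<bullet> y = 0}"
      by (intro AE_not_in) (simp add: negligible_iff_null_sets)
    ultimately have "AE y in lebesgue. y \<notin> K"
      by eventually_elim auto
    then have "K \<in> null_sets lebesgue"
      using lmK by (subst AE_iff_null_sets) auto
    then show False
      using V by (simp add: V_def measure_def null_sets_def)
  qed

  have hom: "(Hp / (Hp + Hm)) ^ d * V \<le> Vp"
    unfolding V_def Vp_def Kp_def d_def
  proof (rule measure_halfspace_ge_homothety[OF K(1,2)])
    show "- Hm \<le> v \<bullet> z" if "z \<in> K" for z
      using m(2)[OF that] by (simp add: Hm)
  qed (use p Hp Hp0 Hm0 in \<open>auto simp: Kp_def\<close>)
  have "(Hp / (Hp + Hm)) ^ d * V > 0"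
    using \<open>Hp > 0\<close> Hm0 V by simp
  then have Vp: "Vp > 0"
    using hom by simp
  define x where "x = root d (Vp / V)"
  have x: "x > 0" "x ^ d = Vp / V"
    using V Vp \<open>d \<ge> 2\<close> by (auto simp: x_def)
  have x_ge: "Hp / (Hp + Hm) \<le> x"
  proof -
    have "(Hp / (Hp + Hm)) ^ d \<le> x ^ d"
      using hom V by (simp add: x(2) le_divide_eq)
    then show ?thesis
      using \<open>Hp > 0\<close> Hm0 x(1) \<open>d \<ge> 2\<close> by (subst (asm) power_mono_iff) auto
  qed

  \<comment> \<open>If \<open>Hp \<ge> d * Hm\<close>, the homothety bound alone suffices; otherwise it gives \<open>q \<le> x\<close>, which
    is what makes the shift \<open>\<Lambda>\<close> small compared with the height \<open>\<tau> / x\<close> of the comparison cone.\<close>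
  have *: "d / (d + 1) * (1 - lam) \<le> x"
  proof (cases "Hp \<ge> d * Hm")
    case True
    have "d / (d + 1) * (1 - lam) \<le> d / (d + 1) * 1"
      using \<open>0 \<le> lam\<close> by (intro mult_left_mono) auto
    also have "\<dots> \<le> Hp / (Hp + Hm)"
      using True \<open>Hp > 0\<close> Hm0 by (simp add: field_simps)
    finally show ?thesis
      using x_ge by simp
  next
    case False
    \<comment> \<open>The case assumption gives \<open>Hp + Hm < (d + 1) * Hm\<close>, so only the
      denominators are compared.\<close>
    have "q \<le> Hp / (Hp + Hm)"
      unfolding q_def using False \<open>Hp > 0\<close> Hm0 by (intro divide_left_mono mult_pos_pos) (auto simp: algebra_simps)
    then have q: "0 \<le> q" "q \<le> x"
      using x_ge \<open>Hp > 0\<close> Hm0 by (auto simp: q_def)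
    define \<tau> where "\<tau> = (n + 1) * Vp / h 0"
    \<comment> \<open>\<open>Brunn_slices\<close> speaks of points of \<open>K\<close>. Since every
      height in the interval is attained, it yields concavity in the height.\<close>
    have surj: "\<exists>z\<in>K. v \<bullet> z = a" if "a \<in> {-Hm..Hp}" for a
    proof -
      have "connected ((\<lambda>z. v \<bullet> z) ` K)"
        by (intro connected_continuous_image continuous_intros convex_connected K)
      moreover have "- Hm \<in> (\<lambda>z. v \<bullet> z) ` K" "Hp \<in> (\<lambda>z. v \<bullet> z) ` K"
        using m(1) p(1) by (auto simp: Hm Hp Kp_def)
      ultimately have "{-Hm..Hp} \<subseteq> (\<lambda>z. v \<bullet> z) ` K"
        by (rule connected_contains_Icc)
      then show ?thesis
        using that by auto
    qed
    have slices: "has_bochner_integral lborel (\<lambda>t. f t * h t) (\<integral>y. f (v \<bullet> y) * indicator K y \<partial>lborel)"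
      if "f \<in> borel_measurable borel" "integrable lborel (\<lambda>y. f (v \<bullet> y) * indicator K y)" for f
      unfolding h_def by (rule has_bochner_integral_slices[OF v K(1) that])
    have hint: "has_bochner_integral lborel h V"
    proof -
      have "(\<integral>y. indicator K y \<partial>lborel) = V"
        using borel_compact[OF K(1)] by (simp add: V_def)
      then show ?thesis
        using slices[of "\<lambda>_. 1"] int[of "\<lambda>_. 1"] by simp
    qed
    have tint: "has_bochner_integral lborel (\<lambda>t. t * h t) I"
      unfolding I_def using int[OF cont] by (intro slices) auto
    have pint: "has_bochner_integral lborel (\<lambda>t. h t * indicator {0..} t) Vp"
    proof -
      have eq: "(\<lambda>y. indicator {0..} (v \<bullet> y) * indicator K y) = (indicator Kp :: 'a \<Rightarrow> real)"
        by (auto simp: Kp_def indicator_def)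
      have "integrable lborel (indicator Kp :: 'a \<Rightarrow> real)"
        using borel_compact[OF Kp] emeasure_compact_finite[OF Kp] by (simp add: less_top[symmetric])
      moreover have "(\<integral>y. indicator Kp y \<partial>lborel) = Vp"
        using borel_compact[OF Kp] by (simp add: Vp_def)
      ultimately show ?thesis
        using slices[of "indicator {0..}"] unfolding eq by (simp add: mult.commute)
    qed
    have "I \<le> V * (\<tau> - \<tau> / x * ((n + 1) / (n + 2)))"
    proof -
      have "(\<integral>t. t * h t \<partial>lborel) \<le> V * (\<tau> - \<tau> / x * ((n + 1) / (n + 2)))"
      proof (rule cone_moment_comparison[OF n(1) \<open>Hp > 0\<close>, of Hm])
        show "h t \<ge> 0" for t
          by (simp add: h_def slice_vol_nonneg)
        show "h t = 0" if "t \<notin> {-Hm..Hp}" for t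
        proof -
          have "slice_cylinder v K t 1 = {}"
          proof (rule equals0I)
            fix y assume "y \<in> slice_cylinder v K t 1"
            then have "y + (t - v \<bullet> y) *\<^sub>R v \<in> K"
              by (simp add: slice_cylinder_def)
            from p_max[OF this] m(2)[OF this] that show False
              by (simp add: inner_add_right vv Hm)
          qed
          then show ?thesis
            by (simp add: h_def slice_vol_def)
        qed
        fix a b \<theta> :: real
        assume "a \<in> {-Hm..Hp}" "b \<in> {-Hm..Hp}" and \<theta>: "0 \<le> \<theta>" "\<theta> \<le> 1"
        then obtain y z where "y \<in> K" "z \<in> K" "a = v \<bullet> y" "b = v \<bullet> z"
          using surj by metis
        then show "(1 - \<theta>) * root n (h a) + \<theta> * root n (h b) \<le> root n (h ((1 - \<theta>) * a + \<theta> * b))"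
          unfolding h_def using \<theta> by (simp add: Brunn_slices[OF v K(1,2) n(3,1)])
      next
        show "x ^ (n + 1) * V = Vp"
          using x(2) V by (simp add: n(2))
      qed (use h0 hint tint pint Vp x Hm0 in \<open>auto simp: \<tau>_def has_bochner_integral_iff\<close>)
      then show ?thesis
        using tint by (simp add: has_bochner_integral_iff)
    qed
    then have "I / V \<le> \<tau> - \<tau> / x * ((n + 1) / (n + 2))"
      using V by (simp add: divide_le_eq mult.commute)
    then have "- \<Lambda> \<le> \<tau> - \<tau> / x * ((n + 1) / (n + 2))"
      using cg I by simp
    then have "(n + 1) / (n + 2) * (1 - lam) \<le> x"
      using x V unfolding \<Lambda>
      by (intro cone_ratio_bound[OF V Vp h0(2) x(1) _ q \<open>0 \<le> lam\<close> \<tau>_def]) (auto simp: n(2))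
    then show ?thesis
      by (simp add: n(2) add.commute)
  qed
  have "exp (-1) * (1 - lam) ^ d \<le> (d / (d + 1)) ^ d * (1 - lam) ^ d"
    using exp_minus_one_le_power[of d] n \<open>lam \<le> 1\<close> by (intro mult_right_mono) auto
  also have "\<dots> = (d / (d + 1) * (1 - lam)) ^ d"
    by (simp only: power_mult_distrib)
  also have "\<dots> \<le> x ^ d"
    using * \<open>lam \<le> 1\<close> by (intro power_mono mult_nonneg_nonneg) auto
  finally show ?thesis
    by (simp add: x(2) V_def Vp_def)
qed

end
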